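(* Let $p$ be fixed. Suppose that Assumption 3 (written out in the context) is satisfied, $\mathbb{E}|X_1|^4<\infty$, and that the tuning parameters $\lambda=\lambda_n>0$ satisfy $\lambda\to0$ and $\sqrt n\,\lambda\to\infty$ as $n\to\infty$. Let $\hat\theta$ be the RankLasso estimator with tuning parameter $\lambda$ and $\hat T=\{1\le j\le p:\hat\theta_j\ne0\}$. (a) If $\lim_{n\to\infty}P(\hat T=T)=1$, then $$\left|H_2'H_1^{-1}\,\mathrm{sign}(\theta^*_T)\right|_\infty\le1.$$ (b) If $$\left|H_2'H_1^{-1}\,\mathrm{sign}(\theta^*_T)\right|_\infty<1,$$ then $\lim_{n\to\infty}P(\hat T=T)=1$.
   Context: Model: $Y_i=g(\beta'X_i,\varepsilon_i)\in\mathbb{R}$, $i=1,\dots,n$, with random predictors $X_i\in\mathbb{R}^p$, noise variables $\varepsilon_i$, a (measurable) link function $g$ and $\beta\in\mathbb{R}^p$; $p$, $\beta$, $g$ and the law of $(X_1,\varepsilon_1)$ do not depend on $n$. $'$ denotes transpose; "increasing" means strictly increasing; $\mathrm{sign}$ acts componentwise. It is assumed (without loss of generality) that $T=\{j:\beta_j\ne0\}=\{1,\dots,p_0\}$ with $0<p_0<p$; $\theta_T$ is the restriction of $\theta$ to indices in $T$. Assumption 3: (i) $(X_1,\varepsilon_1),(X_2,\varepsilon_2),\dots$ are i.i.d., the distribution of $X_1$ is absolutely continuous, $X_1$ is independent of $\varepsilon_1$, $\mathbb{E}X_1=0$, $H=\mathbb{E}X_1X_1'$ is positive definite and $H_{jj}=1$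 for all $j$; (ii) for each $\theta\in\mathbb{R}^p$, $\mathbb{E}(\theta'X_1\mid\beta'X_1)$ exists and equals $d_\theta\beta'X_1$ for some $d_\theta\in\mathbb{R}$; (iii) the cumulative distribution function $F$ of $Y_1$ is increasing and $g$ is increasing with respect to its first argument. $H=\begin{pmatrix}H_1&H_2\\H_2'&H_3\end{pmatrix}$ with $H_1$ of size $p_0\times p_0$ and $H_2$ of size $p_0\times(p-p_0)$. $\theta^*=H^{-1}\mu$, where $\mu=\mathbb{E}[\mathbb{I}(Y_2\le Y_1)X_1]$. RankLasso: with ranks $R_i=\sum_{j=1}^n\mathbb{I}(Y_j\le Y_i)$ and $Q(\theta)=\frac1{2n}\sum_{i=1}^n(R_i/n-0.5-\theta'X_i)^2$, $\hat\theta\in\arg\min_{\theta\in\mathbb{R}^p}\{Q(\theta)+\lambda|\theta|_1\}$, where $|\theta|_1=\sum_j|\theta_j|$. *)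

theory Defs
  imports "HOL-Probability.Probability"
begin

text \<open>
  Observations are indexed from 0: the sample of size \<open>n\<close> is \<open>(X 0, Y 0), \<dots>, (X (n-1), Y (n-1))\<close>,
  so \<open>X 0\<close> plays the role of \<open>X\<^sub>1\<close>.

  Coordinates of \<open>\<real>\<^sup>p\<close> are indexed by a sum type \<open>'s + 'u\<close> of two finite (hence nonempty) types:
  \<open>Inl\<close> enumerates \<open>{1,\<dots>,p\<^sub>0}\<close> and \<open>Inr\<close> enumerates \<open>{p\<^sub>0+1,\<dots>,p}\<close>, with \<open>p\<^sub>0 = CARD('s)\<close> and
  \<open>p = CARD('s) + CARD('u)\<close>; thus \<open>0 < p\<^sub>0 < p\<close> holds automatically.
\<close>

definition supp :: "real ^ 'p \<Rightarrow> 'p set"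
  where "supp \<theta> = {j. \<theta> $ j \<noteq> 0}"

definition restrict_T :: "real ^ ('s::finite + 'u::finite) \<Rightarrow> real ^ 's"
  where "restrict_T \<theta> = (\<chi> i. \<theta> $ Inl i)"

definition block1 :: "real ^ ('s::finite + 'u::finite) ^ ('s + 'u) \<Rightarrow> real ^ 's ^ 's"
  where "block1 A = (\<chi> i j. A $ Inl i $ Inl j)"

definition block2 :: "real ^ ('s::finite + 'u::finite) ^ ('s + 'u) \<Rightarrow> real ^ 'u ^ 's"
  where "block2 A = (\<chi> i j. A $ Inl i $ Inr j)"

text \<open>Componentwise sign; the library's \<open>sgn\<close> on vectors is \<open>x /\<^sub>R norm x\<close> instead.\<close>

definition sign_vec :: "real ^ 'm \<Rightarrow> real ^ 'm"
  where "sign_vec v = (\<chi> i. sgn (v $ i))"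

definition l1_norm :: "real ^ 'p \<Rightarrow> real"
  where "l1_norm \<theta> = (\<Sum>j\<in>UNIV. \<bar>\<theta> $ j\<bar>)"

definition positive_definite :: "real ^ 'p ^ 'p \<Rightarrow> bool"
  where "positive_definite A \<longleftrightarrow> transpose A = A \<and> (\<forall>v. v \<noteq> 0 \<longrightarrow> 0 < v \<bullet> (A *v v))"

definition response ::
    "(real \<Rightarrow> 'e \<Rightarrow> real) \<Rightarrow> real ^ 'p \<Rightarrow> (nat \<Rightarrow> 'w \<Rightarrow> real ^ 'p) \<Rightarrow> (nat \<Rightarrow> 'w \<Rightarrow> 'e)
      \<Rightarrow> nat \<Rightarrow> 'w \<Rightarrow> real"
  where "response g \<beta> X \<epsilon> i \<omega> = g (\<beta> \<bullet> X i \<omega>) (\<epsilon> i \<omega>)"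

definition second_moment :: "'w measure \<Rightarrow> ('w \<Rightarrow> real ^ 'p) \<Rightarrow> real ^ 'p ^ 'p"
  where "second_moment M Z = (\<chi> j k. \<integral>\<omega>. Z \<omega> $ j * Z \<omega> $ k \<partial>M)"

definition mu_vec :: "'w measure \<Rightarrow> (nat \<Rightarrow> 'w \<Rightarrow> real ^ 'p) \<Rightarrow> (nat \<Rightarrow> 'w \<Rightarrow> real) \<Rightarrow> real ^ 'p"
  where "mu_vec M X Y = (\<integral>\<omega>. of_bool (Y 1 \<omega> \<le> Y 0 \<omega>) *\<^sub>R X 0 \<omega> \<partial>M)"

definition theta_star ::
    "'w measure \<Rightarrow> (nat \<Rightarrow> 'w \<Rightarrow> real ^ 'p) \<Rightarrow> (nat \<Rightarrow> 'w \<Rightarrow> real) \<Rightarrow> real ^ 'p"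
  where "theta_star M X Y = matrix_inv (second_moment M (X 0)) *v mu_vec M X Y"

definition sigma_of :: "'w measure \<Rightarrow> ('w \<Rightarrow> 'b) \<Rightarrow> 'b measure \<Rightarrow> 'w measure"
  where "sigma_of M Z B = vimage_algebra (space M) Z B"

text \<open>
  Independence of two random elements, via independence of the sigma-algebras they generate;
  the library's \<open>indep_var\<close> would force both to have the same value type.
\<close>

definition indep_elements ::
    "'w measure \<Rightarrow> 'a measure \<Rightarrow> ('w \<Rightarrow> 'a) \<Rightarrow> 'b measure \<Rightarrow> ('w \<Rightarrow> 'b) \<Rightarrow> bool"
  where "indep_elements M A U B V \<longleftrightarrow> U \<in> measurable M A \<and> V \<in> measurable M B \<and>
    prob_space.indep_set M (sets (sigma_of M U A)) (sets (sigma_of M V B))"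

text \<open>For observed data \<open>x\<close>, \<open>y\<close>: ranks, empirical loss and minimisers of the penalised loss.\<close>

definition rank_in :: "nat \<Rightarrow> (nat \<Rightarrow> real) \<Rightarrow> nat \<Rightarrow> real"
  where "rank_in n y i = (\<Sum>j<n. of_bool (y j \<le> y i))"

definition rank_loss :: "nat \<Rightarrow> (nat \<Rightarrow> real ^ 'p) \<Rightarrow> (nat \<Rightarrow> real) \<Rightarrow> real ^ 'p \<Rightarrow> real"
  where "rank_loss n x y \<theta> =
    1 / (2 * real n) * (\<Sum>i<n. (rank_in n y i / real n - 1 / 2 - \<theta> \<bullet> x i)\<^sup>2)"

definition is_rank_lasso ::
    "nat \<Rightarrow> (nat \<Rightarrow> real ^ 'p) \<Rightarrow> (nat \<Rightarrow> real) \<Rightarrow> real \<Rightarrow> real ^ 'p \<Rightarrow> bool"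
  where "is_rank_lasso n x y lam \<theta> \<longleftrightarrow>
    is_arg_min (\<lambda>\<theta>'. rank_loss n x y \<theta>' + lam * l1_norm \<theta>') (\<lambda>_. True) \<theta>"

end

theory Submission
  imports Defs
begin

text \<open>
  Write \<open>A\<^sub>n\<close> for the negative gradient of the loss at \<open>\<theta>\<^sup>*\<close> and \<open>C\<^sub>n\<close> for the
  empirical second moment matrix. Both \<open>A\<^sub>n\<close> and \<open>C\<^sub>n - H\<close> are V-statistics of order two with a
  square-integrable kernel that is centred off the diagonal, so their second moments are \<open>O(1/n)\<close>;
  as \<open>\<surd>n \<lambda> \<rightarrow> \<infinity>\<close>, the event \<open>|A\<^sub>n| \<le> \<eta> \<lambda>\<close>, \<open>|C\<^sub>n - H| \<le> \<eta>\<close> has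
  probability tending to 1 for every \<open>\<eta> > 0\<close>.

  On it the stationarity conditions read \<open>H \<Delta> = r - \<lambda> s\<close> with \<open>\<Delta>\<close> the error of the estimator,
  \<open>s\<close> a subgradient of the \<open>l\<^sub>1\<close> norm and \<open>|r| = O(\<eta> \<lambda>)\<close>. Coercivity of \<open>H\<close> gives
  \<open>|\<Delta>| = O(\<lambda>)\<close>, so the signs on \<open>T\<close> are those of \<open>\<theta>\<^sup>*\<close>. Pairing with \<open>(- H\<^sub>1\<^sup>-\<^sup>1 H\<^sub>2 v, v)\<close>
  eliminates the \<open>T\<close>-block: for \<open>\<Delta>\<close> supported on \<open>T\<close> and \<open>v\<close> a unit vector this bounds the
  irrepresentability constant by \<open>1 + O(\<eta>)\<close>; for \<open>v\<close> the part of \<open>\<Delta>\<close> off \<open>T\<close>, if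
  nonzero, it bounds that constant from below by \<open>1 - O(\<eta>)\<close>.

  Finally \<open>\<theta>\<^sup>* = \<gamma> \<beta>\<close> with \<open>\<gamma> > 0\<close>: by linearity of the conditional expectations
  \<open>\<mu> = E[F(Y) X]\<close> is a multiple of \<open>H \<beta>\<close>, and \<open>\<beta>'\<mu> = E[F(Y) \<beta>'X] > 0\<close> because \<open>F(Y)\<close> is
  increasing in \<open>\<beta>'X\<close>.
\<close>

subsection \<open>Block matrices and Schur complements\<close>

text \<open>The quadratic form attains its minimum on the compact unit sphere, and that minimum is
  positive. Homogeneity of degree two extends the bound to all vectors, with the minimum as the
  constant.\<close>

lemma positive_definite_coercive:
  fixes A :: "real ^ 'p ^ 'p"
  assumes "positive_definite A"
  obtains c where "c > 0" "\<And>v. c * (norm v)\<^sup>2 \<le> v \<bullet> (A *v v)"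
proof -
  have "continuous_on (sphere 0 1) (\<lambda>v. v \<bullet> (A *v v))"
    by (intro continuous_intros matrix_vector_mult_linear_continuous_on)
  moreover have "sphere 0 1 \<noteq> ({} :: (real ^ 'p) set)"
    by simp
  ultimately have "\<exists>u\<in>sphere (0 :: real ^ 'p) 1. \<forall>v\<in>sphere 0 1. u \<bullet> (A *v u) \<le> v \<bullet> (A *v v)"
    by (intro continuous_attains_inf) auto
  then obtain u :: "real ^ 'p" where u: "norm u = 1" 
      and min: "\<And>v. norm v = 1 \<Longrightarrow> u \<bullet> (A *v u) \<le> v \<bullet> (A *v v)"
    by auto
  show thesis
  proof (rule that)
    show "u \<bullet> (A *v u) > 0"
      using assms u unfolding positive_definite_def by (metis norm_zero zero_neq_one)
    show "u \<bullet> (A *v u) * (norm v)\<^sup>2 \<le> v \<bullet> (A *v v)" for v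
    proof (cases "v = 0")
      case False
      then have "u \<bullet> (A *v u) \<le> sgn v \<bullet> (A *v sgn v)"
        by (intro min) (simp add: norm_sgn)
      also have "\<dots> = v \<bullet> (A *v v) / (norm v)\<^sup>2"
        using False by (simp add: sgn_div_norm matrix_vector_mult_scaleR power2_eq_square field_simps)
      finally show ?thesis
        using False by (simp add: field_simps)
    qed simp
  qed
qed

lemma positive_definite_invertible:
  fixes A :: "real ^ 'p ^ 'p"
  assumes "positive_definite A"
  shows "invertible A"
  unfolding invertible_left_inverse matrix_left_invertible_ker
  using assms unfolding positive_definite_def by (metis inner_zero_right less_irrefl)

lemma sum_UNIV_Plus:
  "(\<Sum>j\<in>(UNIV :: ('s::finite + 'u::finite) set). f j) = (\<Sum>i\<in>UNIV. f (Inl i)) + (\<Sum>i\<in>UNIV. f (Inr i))"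
  by (simp add: UNIV_Plus_UNIV [symmetric] sum.Plus del: UNIV_Plus_UNIV)

definition restrict_U :: "real ^ ('s::finite + 'u::finite) \<Rightarrow> real ^ 'u"
  where "restrict_U \<theta> = (\<chi> i. \<theta> $ Inr i)"

definition join :: "real ^ 's::finite \<Rightarrow> real ^ 'u::finite \<Rightarrow> real ^ ('s + 'u)"
  where "join a b = (\<chi> j. case j of Inl i \<Rightarrow> a $ i | Inr i \<Rightarrow> b $ i)"

lemma restrict_join [simp]: "restrict_T (join a b) = a" "restrict_U (join a b) = b"
  by (simp_all add: restrict_T_def restrict_U_def join_def vec_eq_iff)

lemma inner_blocks: "u \<bullet> v = restrict_T u \<bullet> restrict_T v + restrict_U u \<bullet> restrict_U v"
  by (simp add: inner_vec_def restrict_T_def restrict_U_def sum_UNIV_Plus)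

lemma restrict_T_matrix_mult:
  "restrict_T (A *v v) = block1 A *v restrict_T v + block2 A *v restrict_U v"
  by (simp add: vec_eq_iff restrict_T_def restrict_U_def block1_def block2_def
      matrix_vector_mult_def sum_UNIV_Plus)

text \<open>Padding \<open>v\<close> by zeros turns the quadratic form of the block into that of the
  whole matrix.\<close>

lemma positive_definite_block1:
  assumes "positive_definite A"
  shows "positive_definite (block1 A)"
proof -
  have sym: "A $ i $ j = A $ j $ i" for i j
  proof -
    have "transpose A $ j $ i = A $ j $ i"
      using assms by (simp add: positive_definite_def)
    then show ?thesis
      by (simp add: transpose_def)
  qed
  have "0 < v \<bullet> (block1 A *v v)" if "v \<noteq> 0" for v
  proof -
    have "join v 0 \<noteq> (0 :: real ^ ('a + 'b))"
      using that by (auto simp: join_def vec_eq_iff split: sum.splits)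
    then have "0 < join v 0 \<bullet> (A *v join v 0)"
      using assms unfolding positive_definite_def by blast
    then show ?thesis
      by (simp add: inner_blocks restrict_T_matrix_mult)
  qed
  then show ?thesis
    by (simp add: positive_definite_def transpose_def block1_def vec_eq_iff sym)
qed

text \<open>For the covariance matrix of the predictors this is the matrix of regression
  coefficients of the predictors off \<open>T\<close> on those in \<open>T\<close>. Applied to the
  sign vector, it gives the quantity that the theorem compares with 1.\<close>

definition irrepresentability_matrix :: "real ^ ('s::finite + 'u::finite) ^ ('s + 'u) \<Rightarrow> real ^ 's ^ 'u"
  where "irrepresentability_matrix A = transpose (block2 A) ** matrix_inv (block1 A)"

text \<open>
  The vector with \<open>U\<close>-block \<open>v\<close> whose image under \<open>A\<close> has \<open>T\<close>-block zero, so that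
  pairing it with the stationarity equation eliminates the coefficients in \<open>T\<close>.
\<close>

definition schur_dir :: "real ^ ('s::finite + 'u::finite) ^ ('s + 'u) \<Rightarrow> real ^ 'u \<Rightarrow> real ^ ('s + 'u)"
  where "schur_dir A v = join (- (v v* irrepresentability_matrix A)) v"

lemma matrix_inv_mult:
  fixes A :: "'a::semiring_1 ^ 'n ^ 'm"
  assumes "invertible A"
  shows "matrix_inv A ** A = mat 1" "A ** matrix_inv A = mat 1"
  using someI_ex[of "\<lambda>B. A ** B = mat 1 \<and> B ** A = mat 1"] assms
  unfolding invertible_def matrix_inv_def by blast+

text \<open>The equation that makes the elimination work. Symmetry of the block moves the product
  under a transpose, where the inverse cancels.\<close>

lemma block1_mult_irrepresentability_matrix:
  assumes "positive_definite A"
  shows "block1 A *v (v v* irrepresentability_matrix A) = block2 A *v v"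
proof -
  have pd: "positive_definite (block1 A)"
    by (rule positive_definite_block1[OF assms])
  then have sym: "transpose (block1 A) = block1 A"
    by (simp add: positive_definite_def)
  have "block1 A ** transpose (irrepresentability_matrix A)
      = transpose (matrix_inv (block1 A) ** block1 A) ** block2 A"
    by (simp add: irrepresentability_matrix_def matrix_transpose_mul transpose_transpose sym matrix_mul_assoc)
  also have "\<dots> = block2 A"
    using matrix_inv_mult(1)[OF positive_definite_invertible[OF pd]] by simp
  finally show ?thesis
    by (metis matrix_vector_mul_assoc transpose_matrix_vector)
qed

lemma restrict_T_schur_dir:
  assumes "positive_definite A"
  shows "restrict_T (A *v schur_dir A v) = 0"
  by (simp add: restrict_T_matrix_mult schur_dir_def block1_mult_irrepresentability_matrix[OF assms] vec.neg)

lemma positive_definite_symmetric: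
  assumes "positive_definite A"
  shows "u \<bullet> (A *v v) = (A *v u) \<bullet> v"
  using assms unfolding positive_definite_def by (metis dot_lmul_matrix transpose_matrix_vector)

text \<open>Once \<open>A\<close> is moved onto the direction, the result has zero
  \<open>T\<close>-block and sees only the \<open>U\<close>-block of \<open>z\<close>. This serves
  the case of a correctly selected support.\<close>

lemma schur_dir_inner_vanish:
  assumes "positive_definite A" "restrict_U z = 0"
  shows "schur_dir A v \<bullet> (A *v z) = 0"
  by (simp add: positive_definite_symmetric[OF assms(1)] inner_blocks[of _ z]
      restrict_T_schur_dir[OF assms(1)] assms(2))

text \<open>After the elimination only the \<open>U\<close>-block of \<open>z\<close> counts, so
  \<open>z\<close> may be replaced by the direction itself. The pairing is then the quadratic form
  of \<open>A\<close> there, that is, the Schur complement of the \<open>T\<close>-block evaluated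
  at the \<open>U\<close>-block of \<open>z\<close>.\<close>

lemma schur_dir_inner_nonneg:
  assumes "positive_definite A"
  shows "0 \<le> schur_dir A (restrict_U z) \<bullet> (A *v z)"
proof -
  define w where "w = schur_dir A (restrict_U z)"
  have "restrict_T (A *v w) = 0" "restrict_U w = restrict_U z"
    unfolding w_def by (simp_all add: restrict_T_schur_dir[OF assms]) (simp add: schur_dir_def)
  then have "w \<bullet> (A *v z) = (A *v w) \<bullet> w"
    by (simp add: positive_definite_symmetric[OF assms] inner_blocks[of "A *v w"])
  also have "\<dots> \<ge> 0"
    using assms unfolding positive_definite_def
    by (metis inner_commute inner_zero_right less_eq_real_def)
  finally show ?thesis
    by (simp add: w_def)
qed

lemma schur_dir_inner:
  "schur_dir A v \<bullet> z = v \<bullet> restrict_U z - v \<bullet> (irrepresentability_matrix A *v restrict_T z)"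
  by (simp add: inner_blocks[of _ z] schur_dir_def dot_lmul_matrix)

lemma schur_dir_bounded:
  obtains D where "D > 0" "\<And>v. norm (schur_dir A v) \<le> D * norm v"
proof -
  have "bounded_linear (schur_dir A)"
    unfolding linear_conv_bounded_linear[symmetric]
    by (rule linearI) (auto simp: schur_dir_def join_def vec_eq_iff vector_matrix_mult_def
        sum.distrib sum_distrib_left algebra_simps split: sum.splits)
  then show thesis
    using that by (metis bounded_linear.pos_bounded mult.commute)
qed

subsection \<open>Stationarity and selection for the lasso\<close>

definition gram :: "nat \<Rightarrow> (nat \<Rightarrow> real ^ 'p) \<Rightarrow> real ^ 'p ^ 'p"
  where "gram n x = (\<chi> j k. (\<Sum>i<n. x i $ j * x i $ k) / real n)"

text \<open>The negative gradient of \<^const>\<open>rank_loss\<close>.\<close>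

definition score :: "nat \<Rightarrow> (nat \<Rightarrow> real ^ 'p) \<Rightarrow> (nat \<Rightarrow> real) \<Rightarrow> real ^ 'p \<Rightarrow> real ^ 'p"
  where "score n x y \<theta> = (\<chi> k. (\<Sum>i<n. (rank_in n y i / real n - 1 / 2 - \<theta> \<bullet> x i) * x i $ k) / real n)"

lemma gram_mult: "(gram n x *v v) $ k = (\<Sum>i<n. (v \<bullet> x i) * x i $ k) / real n"
proof -
  have "(gram n x *v v) $ k = (\<Sum>j\<in>UNIV. \<Sum>i<n. x i $ k * x i $ j * v $ j / real n)"
    by (simp add: gram_def matrix_vector_mult_def sum_divide_distrib sum_distrib_right)
  also have "\<dots> = (\<Sum>i<n. \<Sum>j\<in>UNIV. x i $ k * x i $ j * v $ j / real n)"
    by (rule sum.swap)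
  also have "\<dots> = (\<Sum>i<n. (v \<bullet> x i) * x i $ k) / real n"
    by (simp add: inner_vec_def sum_divide_distrib sum_distrib_left sum_distrib_right ac_simps)
  finally show ?thesis .
qed

text \<open>The ranks do not involve the parameter, so the loss is quadratic with Hessian
  \<open>gram n x\<close> and its gradient is exactly affine.\<close>

lemma score_diff: "score n x y \<theta>' = score n x y \<theta> - gram n x *v (\<theta>' - \<theta>)"
proof -
  have "score n x y \<theta>' $ k = (score n x y \<theta> - gram n x *v (\<theta>' - \<theta>)) $ k" for k
    unfolding vector_minus_component gram_mult
    by (simp add: score_def diff_divide_distrib[symmetric] sum_subtractf[symmetric]
        inner_diff_left algebra_simps)
  then show ?thesis
    by (simp add: vec_eq_iff)
qed

text \<open>Divide by \<open>t\<close> and let it decrease to 0. This turns comparisons of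
  increments into comparisons of slopes without differentiating the absolute value.\<close>

lemma slope_le_if_quadratic_le:
  fixes a b c \<delta> :: real
  assumes "\<delta> > 0" "\<And>t. 0 < t \<Longrightarrow> t < \<delta> \<Longrightarrow> t * a \<le> t * b + t\<^sup>2 * c"
  shows "a \<le> b"
proof (rule tendsto_lowerbound)
  show "((\<lambda>t. b + t * c) \<longlongrightarrow> b) (at_right 0)"
    by (auto intro!: tendsto_eq_intros)
  show "\<forall>\<^sub>F t in at_right 0. a \<le> b + t * c"
    using eventually_at_right_less eventually_at_right_real[OF assms(1)]
  proof eventually_elim
    case (elim t)
    then have "t * a \<le> t * (b + t * c)"
      using assms(2)[of t] by (simp add: algebra_simps power2_eq_square)
    with elim show ?case
      by simp
  qed
qed simp

lemma rank_loss_axis: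
  assumes "n \<ge> 1"
  shows "rank_loss n x y (\<theta> + t *\<^sub>R axis k 1)
    = rank_loss n x y \<theta> - t * score n x y \<theta> $ k + t\<^sup>2 * (gram n x $ k $ k / 2)"
proof -
  define a where "a i = rank_in n y i / real n - 1 / 2 - \<theta> \<bullet> x i" for i
  have "(rank_in n y i / real n - 1 / 2 - (\<theta> + t *\<^sub>R axis k 1) \<bullet> x i)\<^sup>2
      = (a i)\<^sup>2 - 2 * t * (a i * x i $ k) + t\<^sup>2 * (x i $ k * x i $ k)" for i
    by (simp add: a_def inner_add_left inner_axis' power2_eq_square algebra_simps)
  then have "rank_loss n x y (\<theta> + t *\<^sub>R axis k 1) = 1 / (2 * real n) * ((\<Sum>i<n. (a i)\<^sup>2)
      - 2 * t * (\<Sum>i<n. a i * x i $ k) + t\<^sup>2 * (\<Sum>i<n. x i $ k * x i $ k))"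
    by (simp add: rank_loss_def sum.distrib sum_subtractf sum_distrib_left)
  then show ?thesis
    using assms unfolding rank_loss_def score_def gram_def vec_lambda_beta a_def[symmetric]
    by (simp add: field_simps)
qed

lemma l1_norm_axis: "l1_norm (\<theta> + t *\<^sub>R axis k 1) = l1_norm \<theta> + (\<bar>\<theta> $ k + t\<bar> - \<bar>\<theta> $ k\<bar>)"
proof -
  have "l1_norm (\<theta> + t *\<^sub>R axis k 1) - l1_norm \<theta>
      = (\<Sum>j\<in>UNIV. if j = k then \<bar>\<theta> $ k + t\<bar> - \<bar>\<theta> $ k\<bar> else 0)"
    unfolding l1_norm_def sum_subtractf[symmetric] by (intro sum.cong) (auto simp: axis_def)
  then show ?thesis
    by simp
qed

text \<open>Minimality tested against a change of one coordinate. The penalty is separable, so such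
  changes already yield the full stationarity conditions.\<close>

lemma rank_lasso_axis:
  assumes "is_rank_lasso n x y l \<theta>" "n \<ge> 1"
  shows "t * score n x y \<theta> $ k \<le> l * (\<bar>\<theta> $ k + t\<bar> - \<bar>\<theta> $ k\<bar>) + t\<^sup>2 * (gram n x $ k $ k / 2)"
proof -
  have "rank_loss n x y \<theta> + l * l1_norm \<theta>
      \<le> rank_loss n x y (\<theta> + t *\<^sub>R axis k 1) + l * l1_norm (\<theta> + t *\<^sub>R axis k 1)"
    using assms(1) unfolding is_rank_lasso_def is_arg_min_def by (meson not_le)
  then show ?thesis
    unfolding rank_loss_axis[OF assms(2)] l1_norm_axis by (simp add: algebra_simps)
qed

text \<open>A step \<open>t\<close> in coordinate \<open>k\<close> costs at most
  \<open>l * \<bar>t\<bar>\<close> in penalty, and small steps of both signs bound the score. Near a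
  nonzero coordinate the penalty is linear, so the two one-sided inequalities merge into an
  equality.\<close>

lemma rank_lasso_kkt:
  assumes lasso: "is_rank_lasso n x y l \<theta>" "n \<ge> 1" and "l \<ge> 0"
  shows "\<bar>score n x y \<theta> $ k\<bar> \<le> l" and "\<theta> $ k \<noteq> 0 \<Longrightarrow> score n x y \<theta> $ k = l * sgn (\<theta> $ k)"
proof -
  let ?s = "score n x y \<theta> $ k" and ?c = "gram n x $ k $ k / 2"
  have le: "l * (\<bar>\<theta> $ k + t\<bar> - \<bar>\<theta> $ k\<bar>) \<le> l * \<bar>t\<bar>" for t
    using \<open>l \<ge> 0\<close> by (intro mult_left_mono) auto
  note ax = rank_lasso_axis[OF lasso, of _ k]
  have "?s \<le> l"
    by (rule slope_le_if_quadratic_le[of 1 _ _ ?c]) (use ax le in \<open>smt (verit) mult.commute\<close>)+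
  moreover have "- ?s \<le> l"
  proof (rule slope_le_if_quadratic_le[of 1 _ _ ?c])
    fix t :: real assume "0 < t"
    then show "t * - ?s \<le> t * l + t\<^sup>2 * ?c"
      using ax[of "- t"] le[of "- t"] by (simp add: mult.commute)
  qed simp
  ultimately show "\<bar>?s\<bar> \<le> l"
    by simp
  assume nz: "\<theta> $ k \<noteq> 0"
  have eq: "l * (\<bar>\<theta> $ k + t\<bar> - \<bar>\<theta> $ k\<bar>) = t * (l * sgn (\<theta> $ k))" if "\<bar>t\<bar> < \<bar>\<theta> $ k\<bar>" for t
    using that by (auto simp: sgn_if abs_if)
  show "?s = l * sgn (\<theta> $ k)"
  proof (rule antisym)
    show "?s \<le> l * sgn (\<theta> $ k)"
      by (rule slope_le_if_quadratic_le[of "\<bar>\<theta> $ k\<bar>" _ _ ?c]) (use nz ax eq in \<open>smt (verit)\<close>)+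
    have "- ?s \<le> - (l * sgn (\<theta> $ k))"
    proof (rule slope_le_if_quadratic_le[of "\<bar>\<theta> $ k\<bar>" _ _ ?c])
      fix t :: real assume "0 < t" "t < \<bar>\<theta> $ k\<bar>"
      then show "t * - ?s \<le> t * - (l * sgn (\<theta> $ k)) + t\<^sup>2 * ?c"
        using ax[of "- t"] eq[of "- t"] by simp
    qed (use nz in simp)
    then show "l * sgn (\<theta> $ k) \<le> ?s"
      by simp
  qed
qed

text \<open>The deterministic core of the proof: the sample enters only through the error level
  \<open>\<eta>\<close>, while \<open>K\<close> and \<open>\<eta>0\<close> depend on
  \<open>A\<close> and \<open>b\<close> alone. For small \<open>\<eta>\<close>, correct selection
  nearly forces \<open>\<kappa> \<le> 1\<close> and its failure nearly forces
  \<open>\<kappa> \<ge> 1\<close>, which are the two halves of the theorem.\<close>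

lemma rank_lasso_selection_dichotomy:
  fixes A :: "real ^ ('s::finite + 'u::finite) ^ ('s + 'u)"
  assumes pd: "positive_definite A" and supp_b: "supp b = range Inl"
  defines "\<kappa> \<equiv> infnorm (irrepresentability_matrix A *v sign_vec (restrict_T b))"
  obtains K \<eta>0 where "K > 0" "\<eta>0 > 0"
    "\<And>\<eta> l n x y \<theta>. \<lbrakk>0 < \<eta>; \<eta> \<le> \<eta>0; 0 < l; l \<le> \<eta>0; n \<ge> 1; is_rank_lasso n x y l \<theta>;
        norm (score n x y b) \<le> \<eta> * l; \<And>v. norm ((gram n x - A) *v v) \<le> \<eta> * norm v\<rbrakk>
      \<Longrightarrow> if supp \<theta> = range Inl then \<kappa> \<le> 1 + K * \<eta> else 1 \<le> \<kappa> + K * \<eta>"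
proof -
  obtain c where c: "c > 0" "\<And>v. c * (norm v)\<^sup>2 \<le> v \<bullet> (A *v v)"
    using positive_definite_coercive[OF pd] by blast
  obtain D where D: "D > 0" "\<And>v. norm (schur_dir A v) \<le> D * norm v"
    using schur_dir_bounded by blast
  \<comment> \<open>\<open>L\<close> bounds the estimation error in units of \<open>l\<close>. The
    numerator collects the score at \<open>b\<close> and the subgradient; the factor 2 appears
    because half of the coercivity is spent on the Gram error.\<close>
  define L where "L = 2 * (1 + real CARD('s + 'u)) / c"
  have L: "L > 0"
    using c by (simp add: L_def add_pos_nonneg)
  \<comment> \<open>The smallest modulus of \<open>b\<close> on \<open>T\<close>: an error below
    \<open>m\<close> cannot change a sign there.\<close>
  define m where "m = Min (range (\<lambda>i. \<bar>b $ Inl i\<bar>))"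
  have b_nz: "b $ Inl i \<noteq> 0" for i
    using supp_b by (auto simp: supp_def)
  have b_z: "b $ Inr i = 0" for i
    using supp_b by (auto simp: supp_def)
  have m: "m > 0" "\<And>i. m \<le> \<bar>b $ Inl i\<bar>"
    using b_nz by (auto simp: m_def)
  \<comment> \<open>\<open>K\<close> combines the size of the eliminating direction with that of the
    remainder \<open>r\<close>. The three bounds in \<open>\<eta>0\<close> ensure in turn that half
    of the coercivity survives, that the score at \<open>b\<close> is at most \<open>l\<close>, and
    that \<open>L * l\<close> is at most \<open>m / 2\<close>.\<close>
  define K where "K = D * (1 + L)"
  define \<eta>0 where "\<eta>0 = min (min (c / 2) 1) (m / (2 * L))"
  show thesis
  proof (rule that)
    show "K > 0"
      using D L by (simp add: K_def)
    show "\<eta>0 > 0"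
      using c m L by (simp add: \<eta>0_def)
    fix \<eta> l n x y \<theta>
    assume \<eta>: "0 < \<eta>" "\<eta> \<le> \<eta>0" and l: "0 < l" "l \<le> \<eta>0" and n: "(n::nat) \<ge> 1"
      and lasso: "is_rank_lasso n x y l \<theta>" 
      and score_b: "norm (score n x y b) \<le> \<eta> * l"
      and gram_A: "\<And>v. norm ((gram n x - A) *v v) \<le> \<eta> * norm v"
    define d where "d = \<theta> - b"
    define s where "s = score n x y \<theta>"
    \<comment> \<open>The remainder that allows stationarity to be written with the population
      matrix \<open>A\<close>: it carries the score at \<open>b\<close> and the Gram error.\<close>
    define r where "r = score n x y b - (gram n x - A) *v d"
    have kkt: "\<bar>s $ k\<bar> \<le> l" "\<theta> $ k \<noteq> 0 \<Longrightarrow> s $ k = l * sgn (\<theta> $ k)" for k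
      using rank_lasso_kkt[OF lasso n] l by (simp_all add: s_def)
    have A_d: "A *v d = r - s"
      by (simp add: r_def s_def d_def score_diff[of n x y \<theta> b] matrix_vector_mult_diff_rdistrib)
    have norm_s: "norm s \<le> real CARD('s + 'u) * l"
    proof -
      have "norm s \<le> (\<Sum>k\<in>UNIV. \<bar>s $ k\<bar>)"
        by (rule norm_le_l1_cart)
      also have "\<dots> \<le> real CARD('s + 'u) * l"
        by (rule sum_bounded_above) (simp add: kkt)
      finally show ?thesis .
    qed
    \<comment> \<open>Pair stationarity with \<open>d\<close> and use coercivity. The quadratic term
      from the Gram error is absorbed on the left because \<open>\<eta> \<le> c / 2\<close>.\<close>
    have norm_d: "norm d \<le> L * l"
    proof (cases "d = 0")
      case False
      have "c * (norm d)\<^sup>2 \<le> d \<bullet> (score n x y b - s) - d \<bullet> ((gram n x - A) *v d)"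
        using c(2)[of d] unfolding A_d r_def by (simp add: inner_diff_right)
      also have "\<dots> \<le> norm d * (norm (score n x y b) + norm s) + norm d * (\<eta> * norm d)"
      proof -
        have "d \<bullet> (score n x y b - s) \<le> norm d * (norm (score n x y b) + norm s)"
          by (rule order_trans[OF norm_cauchy_schwarz]) (simp add: mult_left_mono norm_triangle_ineq4)
        moreover have "- (d \<bullet> ((gram n x - A) *v d)) \<le> norm d * (\<eta> * norm d)"
          using norm_cauchy_schwarz[of "- d" "(gram n x - A) *v d"] gram_A[of d]
          by (smt (verit) inner_minus_left mult_left_mono norm_ge_zero norm_minus_cancel)
        ultimately show ?thesis
          by simp
      qed
      also have "\<dots> \<le> norm d * (l + real CARD('s + 'u) * l) + norm d * (c / 2 * norm d)"
      proof -
        have "\<eta> \<le> 1" "\<eta> \<le> c / 2"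
          using \<eta> by (simp_all add: \<eta>0_def)
        then have "norm (score n x y b) \<le> l"
          using score_b mult_right_mono[OF \<open>\<eta> \<le> 1\<close>, of l] l by linarith
        then show ?thesis
          using norm_s \<open>\<eta> \<le> c / 2\<close> by (intro add_mono mult_left_mono mult_right_mono) auto
      qed
      finally have "norm d * (c / 2 * norm d) \<le> norm d * (l + real CARD('s + 'u) * l)"
        by (simp add: power2_eq_square algebra_simps)
      then have "c / 2 * norm d \<le> l + real CARD('s + 'u) * l"
        using False by simp
      then show ?thesis
        using c by (simp add: L_def field_simps)
    qed (use L l in simp)
    have norm_r: "norm r \<le> \<eta> * (1 + L) * l"
    proof -
      have "norm r \<le> \<eta> * l + \<eta> * norm d"
        unfolding r_def by (rule order_trans[OF norm_triangle_ineq4]) (use score_b gram_A[of d] in simp)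
      also have "\<dots> \<le> \<eta> * l + \<eta> * (L * l)"
        using norm_d \<eta> by simp
      finally show ?thesis
        by (simp add: algebra_simps)
    qed
    have sgn_\<theta>: "sgn (\<theta> $ Inl i) = sgn (b $ Inl i)" for i
    proof -
      have "\<bar>\<theta> $ Inl i - b $ Inl i\<bar> \<le> norm d"
        using component_le_norm_cart[of d "Inl i"] by (simp add: d_def)
      also have "\<dots> \<le> L * l"
        by (fact norm_d)
      also have "\<dots> \<le> L * (m / (2 * L))"
        using l L by (intro mult_left_mono) (auto simp: \<eta>0_def)
      also have "\<dots> < m"
        using L m by simp
      finally show ?thesis
        using m(2)[of i] by (auto simp: sgn_if abs_if split: if_splits)
    qed
    have \<theta>_nz: "\<theta> $ Inl i \<noteq> 0" for i
      using sgn_\<theta>[of i] b_nz[of i] by (metis sgn_0_0)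
    have s_T: "restrict_T s = l *\<^sub>R sign_vec (restrict_T b)"
      using kkt(2)[OF \<theta>_nz] by (simp add: vec_eq_iff restrict_T_def sign_vec_def sgn_\<theta>)
    define q where "q = irrepresentability_matrix A *v sign_vec (restrict_T b)"
    \<comment> \<open>On \<open>T\<close> the subgradient equals \<open>l\<close> times the known
      signs, which produces the term with \<open>q\<close>; only its \<open>U\<close>-part stays
      undetermined.\<close>
    have key: "schur_dir A v \<bullet> (A *v d) = schur_dir A v \<bullet> r - v \<bullet> restrict_U s + l * (v \<bullet> q)" for v
      by (simp add: A_d inner_diff_right) (simp add: schur_dir_inner s_T q_def matrix_vector_mult_scaleR)
    have rem: "\<bar>schur_dir A v \<bullet> r\<bar> \<le> K * \<eta> * norm v * l" for v
    proof -
      have "\<bar>schur_dir A v \<bullet> r\<bar> \<le> norm (schur_dir A v) * norm r"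
        by (rule Cauchy_Schwarz_ineq2)
      also have "\<dots> \<le> (D * norm v) * (\<eta> * (1 + L) * l)"
        using D norm_r by (intro mult_mono) auto
      finally show ?thesis
        by (simp add: K_def ac_simps)
    qed
    have d_U: "restrict_U d = restrict_U \<theta>"
      by (simp add: vec_eq_iff restrict_U_def d_def b_z)
    show "if supp \<theta> = range Inl then \<kappa> \<le> 1 + K * \<eta> else 1 \<le> \<kappa> + K * \<eta>"
    proof (cases "supp \<theta> = range Inl")
      case True
      then have "restrict_U d = 0"
        unfolding d_U by (auto simp: supp_def restrict_U_def vec_eq_iff)
      then have zero: "schur_dir A v \<bullet> (A *v d) = 0" for v
        by (rule schur_dir_inner_vanish[OF pd])
      \<comment> \<open>For a unit vector the left side of \<open>key\<close> is zero, so
        \<open>l * q $ j\<close> is a subgradient component, at most \<open>l\<close> in modulus, up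
        to the remainder.\<close>
      have "\<bar>q $ j\<bar> \<le> 1 + K * \<eta>" for j
      proof -
        have "l * q $ j = s $ Inr j - schur_dir A (axis j 1) \<bullet> r"
          using key[of "axis j 1"] zero[of "axis j 1"] by (simp add: inner_axis' restrict_U_def)
        then have "\<bar>l * q $ j\<bar> \<le> l + K * \<eta> * l"
          using kkt(1)[of "Inr j"] rem[of "axis j 1"] by (simp add: norm_axis_1)
        then have "l * \<bar>q $ j\<bar> \<le> l * (1 + K * \<eta>)"
          using l by (simp add: abs_mult algebra_simps)
        then show ?thesis
          using l by simp
      qed
      then have "infnorm q \<le> 1 + K * \<eta>"
        by (auto simp: infnorm_Max Basis_vec_def inner_axis)
      then show ?thesis
        using True by (simp add: \<kappa>_def q_def)
    next
      case False
      \<comment> \<open>All coordinates in \<open>T\<close> are already nonzero, so a wrong support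
        can only mean that the \<open>U\<close>-block of the estimator is nonzero.\<close>
      define v where "v = restrict_U \<theta>"
      have "v \<noteq> 0"
      proof
        assume "v = 0"
        then have "\<theta> $ Inr i = 0" for i
          by (simp add: v_def restrict_U_def vec_eq_iff)
        then have "supp \<theta> = range Inl"
          using \<theta>_nz by (auto simp: supp_def) (metis Inl_Inr_False sum.exhaust rangeI)
        with False show False ..
      qed
      then have pos: "l1_norm v > 0"
        using norm_le_l1_cart[of v] unfolding l1_norm_def by (smt (verit) zero_less_norm_iff)
      \<comment> \<open>At nonzero coordinates the subgradient is extremal with matching sign, so
        the pairing attains the \<open>l1_norm\<close>.\<close>
      have "v \<bullet> restrict_U s = l * l1_norm v"
        unfolding l1_norm_def inner_vec_def sum_distrib_left
      proof (rule sum.cong)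
        fix i
        show "v $ i \<bullet> restrict_U s $ i = l * \<bar>v $ i\<bar>"
          using kkt(2)[of "Inr i"] by (cases "v $ i = 0") (auto simp: v_def restrict_U_def sgn_if abs_if)
      qed simp
      moreover have "v \<bullet> q \<le> l1_norm v * \<kappa>"
        unfolding l1_norm_def inner_vec_def sum_distrib_right
      proof (rule sum_mono)
        fix i
        have "v $ i \<bullet> q $ i \<le> \<bar>v $ i\<bar> * \<bar>q $ i\<bar>"
          by (metis abs_ge_self abs_mult inner_real_def)
        also have "\<dots> \<le> \<bar>v $ i\<bar> * \<kappa>"
          using component_le_infnorm_cart[of q i] by (intro mult_left_mono) (simp_all add: \<kappa>_def q_def)
        finally show "v $ i \<bullet> q $ i \<le> \<bar>v $ i\<bar> * \<kappa>" .
      qed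
      then have "l * (v \<bullet> q) \<le> l * (l1_norm v * \<kappa>)"
        using l by simp
      moreover have "schur_dir A v \<bullet> r \<le> K * \<eta> * l1_norm v * l"
      proof -
        have "K * \<eta> * norm v * l \<le> K * \<eta> * l1_norm v * l"
          using norm_le_l1_cart[of v] \<open>K > 0\<close> \<eta> l unfolding l1_norm_def
          by (intro mult_left_mono mult_right_mono) auto
        then show ?thesis
          using rem[of v] by simp
      qed
      moreover have "0 \<le> schur_dir A v \<bullet> (A *v d)"
        using schur_dir_inner_nonneg[OF pd, of d] by (simp add: d_U v_def)
      \<comment> \<open>Every bound has been expressed as a multiple of the positive number
        \<open>l * l1_norm v\<close>, which can then be divided out.\<close>
      ultimately have "0 \<le> (l * l1_norm v) * (\<kappa> + K * \<eta> - 1)"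
        unfolding key by (simp add: algebra_simps)
      moreover have "0 < l * l1_norm v"
        using l pos by simp
      ultimately show ?thesis
        using False by (simp add: zero_le_mult_iff)
    qed
  qed
qed

subsection \<open>V-statistics\<close>

text \<open>Subfamilies of an independent family over disjoint index sets are independent. The two
  indices within a pair may coincide.\<close>

lemma (in prob_space) product_expectation_disjoint:
  fixes D :: "nat \<Rightarrow> 'a \<Rightarrow> 'd" and \<psi> :: "'d \<Rightarrow> 'd \<Rightarrow> real"
  assumes indep: "indep_vars (\<lambda>_. S) D UNIV"
    and meas: "(\<lambda>(d, d'). \<psi> d d') \<in> borel_measurable (S \<Otimes>\<^sub>M S)"
    and int: "\<And>i j. integrable M (\<lambda>\<omega>. \<psi> (D i \<omega>) (D j \<omega>))"
    and disj: "{i, j} \<inter> {k, l} = {}"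
  shows "expectation (\<lambda>\<omega>. \<psi> (D i \<omega>) (D j \<omega>) * \<psi> (D k \<omega>) (D l \<omega>))
    = expectation (\<lambda>\<omega>. \<psi> (D i \<omega>) (D j \<omega>)) * expectation (\<lambda>\<omega>. \<psi> (D k \<omega>) (D l \<omega>))"
proof -
  have comp: "(\<lambda>f. \<psi> (f i) (f j)) \<in> borel_measurable (PiM {i, j} (\<lambda>_. S))" for i j
    using measurable_compose[OF measurable_Pair meas, of "\<lambda>f. f i" "PiM {i, j} (\<lambda>_. S)" "\<lambda>f. f j"]
    by simp
  have "indep_var borel ((\<lambda>f. \<psi> (f i) (f j)) \<circ> (\<lambda>\<omega>. restrict (\<lambda>i. D i \<omega>) {i, j}))
      borel ((\<lambda>f. \<psi> (f k) (f l)) \<circ> (\<lambda>\<omega>. restrict (\<lambda>i. D i \<omega>) {k, l}))"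
    by (rule indep_var_compose[OF indep_var_restrict[OF indep disj] comp comp]) auto
  then have "indep_var borel (\<lambda>\<omega>. \<psi> (D i \<omega>) (D j \<omega>)) borel (\<lambda>\<omega>. \<psi> (D k \<omega>) (D l \<omega>))"
    by (simp add: o_def)
  then show ?thesis
    by (rule indep_var_lebesgue_integral[OF _ int int])
qed

text \<open>Expanding the square gives expectations over quadruples of indices. A quadruple without
  one of five coincidences contributes 0 by independence and centring; each coincidence holds for
  \<open>n ^ 3\<close> quadruples, and every term is at most \<open>B\<close>. The envelope
  \<open>b\<close> depends on the first argument only, since the second enters the kernels below
  through an indicator at most.\<close>

lemma (in prob_space) V_statistic_second_moment:
  fixes D :: "nat \<Rightarrow> 'a \<Rightarrow> 'd" and \<psi> :: "'d \<Rightarrow> 'd \<Rightarrow> real"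
  assumes indep: "indep_vars (\<lambda>_. S) D UNIV"
    and meas: "(\<lambda>(d, d'). \<psi> d d') \<in> borel_measurable (S \<Otimes>\<^sub>M S)"
    and bound: "\<And>d d'. \<bar>\<psi> d d'\<bar> \<le> b d"
    and b_meas: "b \<in> borel_measurable S"
    and int: "\<And>i. integrable M (\<lambda>\<omega>. (b (D i \<omega>))\<^sup>2)"
    and B: "\<And>i. expectation (\<lambda>\<omega>. (b (D i \<omega>))\<^sup>2) \<le> B"
    and centred: "\<And>i j. i \<noteq> j \<Longrightarrow> expectation (\<lambda>\<omega>. \<psi> (D i \<omega>) (D j \<omega>)) = 0"
  shows "integrable M (\<lambda>\<omega>. (\<Sum>i<n. \<Sum>j<n. \<psi> (D i \<omega>) (D j \<omega>))\<^sup>2)" (is ?int)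
    and "expectation (\<lambda>\<omega>. (\<Sum>i<n. \<Sum>j<n. \<psi> (D i \<omega>) (D j \<omega>))\<^sup>2) \<le> 5 * B * real n ^ 3" (is ?le)
proof -
  define P where "P i j \<omega> = \<psi> (D i \<omega>) (D j \<omega>)" for i j \<omega>
  have D_meas [measurable]: "D i \<in> measurable M S" for i
    using indep by (simp add: indep_vars_def)
  note b_meas [measurable]
  have P_meas [measurable]: "P i j \<in> borel_measurable M" for i j
    unfolding P_def
    using measurable_compose[OF measurable_Pair meas, OF D_meas D_meas] by simp
  have P_le: "\<bar>P i j \<omega>\<bar> \<le> b (D i \<omega>)" for i j \<omega>
    by (simp add: P_def bound)
  have b_nonneg: "0 \<le> b d" for d
    using bound[of d d] by linarith
  have PP_le: "\<bar>P i j \<omega> * P k l \<omega>\<bar> \<le> ((b (D i \<omega>))\<^sup>2 + (b (D k \<omega>))\<^sup>2) / 2" for i j k l \<omega>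
  proof -
    have "\<bar>P i j \<omega> * P k l \<omega>\<bar> \<le> b (D i \<omega>) * b (D k \<omega>)"
      unfolding abs_mult by (intro mult_mono P_le b_nonneg) auto
    also have "\<dots> \<le> ((b (D i \<omega>))\<^sup>2 + (b (D k \<omega>))\<^sup>2) / 2"
      using sum_squares_bound[of "b (D i \<omega>)" "b (D k \<omega>)"] by simp
    finally show ?thesis .
  qed
  have bb_int: "integrable M (\<lambda>\<omega>. ((b (D i \<omega>))\<^sup>2 + (b (D k \<omega>))\<^sup>2) / 2)" for i k
    using int by simp
  have PP_int [simp]: "integrable M (\<lambda>\<omega>. P i j \<omega> * P k l \<omega>)" for i j k l
    by (rule Bochner_Integration.integrable_bound[OF bb_int[of i k]]) (use PP_le in \<open>auto intro!: AE_I2 order_trans[OF _ abs_ge_self]\<close>)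
  have P_int: "integrable M (P i j)" for i j
  proof -
    have "integrable M (\<lambda>\<omega>. (P i j \<omega>)\<^sup>2)"
      using PP_int[of i j i j] by (simp add: power2_eq_square)
    then show ?thesis
      by (rule square_integrable_imp_integrable[rotated]) simp
  qed
  have B_nonneg: "0 \<le> B"
    by (rule order_trans[OF Bochner_Integration.integral_nonneg B[of 0]]) simp
  \<comment> \<open>Quadruples with several coincidences are counted repeatedly, which only weakens
    the bound. The case \<open>k = l\<close> is not listed, because the vanishing mean of the first
    factor already removes the term.\<close>
  have PP_exp: "expectation (\<lambda>\<omega>. P i j \<omega> * P k l \<omega>)
      \<le> B * ((if j = i then 1 else 0) + (if k = i then 1 else 0) + (if l = i then 1 else 0)
             + (if k = j then 1 else 0) + (if l = j then 1 else 0))" (is "_ \<le> B * ?c") for i j k l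
  proof (cases "j = i \<or> k = i \<or> l = i \<or> k = j \<or> l = j")
    case True
    have "expectation (\<lambda>\<omega>. P i j \<omega> * P k l \<omega>) \<le> expectation (\<lambda>\<omega>. ((b (D i \<omega>))\<^sup>2 + (b (D k \<omega>))\<^sup>2) / 2)"
      using PP_le by (intro integral_mono PP_int bb_int) (meson abs_le_D1)
    also have "\<dots> = (expectation (\<lambda>\<omega>. (b (D i \<omega>))\<^sup>2) + expectation (\<lambda>\<omega>. (b (D k \<omega>))\<^sup>2)) / 2"
      using int by simp
    also have "\<dots> \<le> B * 1"
      using B[of i] B[of k] by simp
    also have "\<dots> \<le> B * ?c"
      using True by (intro mult_left_mono B_nonneg) auto
    finally show ?thesis .
  next
    case False
    then have "expectation (\<lambda>\<omega>. P i j \<omega> * P k l \<omega>) = 0"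
      using product_expectation_disjoint[OF indep meas, of i j k l] P_int centred[of i j]
      unfolding P_def by auto
    then show ?thesis
      using False by simp
  qed
  have expand: "(\<Sum>i<n. \<Sum>j<n. P i j \<omega>)\<^sup>2 = (\<Sum>i<n. \<Sum>j<n. \<Sum>k<n. \<Sum>l<n. P i j \<omega> * P k l \<omega>)" for \<omega>
    by (simp add: power2_eq_square sum_distrib_left sum_distrib_right) (simp add: mult.commute)
  show ?int
    unfolding P_def[symmetric] expand by (intro Bochner_Integration.integrable_sum PP_int)
  have "expectation (\<lambda>\<omega>. (\<Sum>i<n. \<Sum>j<n. P i j \<omega>)\<^sup>2)
      = (\<Sum>i<n. \<Sum>j<n. \<Sum>k<n. \<Sum>l<n. expectation (\<lambda>\<omega>. P i j \<omega> * P k l \<omega>))"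
    unfolding expand by (simp add: Bochner_Integration.integral_sum)
  also have "\<dots> \<le> (\<Sum>i<n. \<Sum>j<n. \<Sum>k<n. \<Sum>l<n.
      B * ((if j = i then 1 else 0) + (if k = i then 1 else 0) + (if l = i then 1 else 0)
             + (if k = j then 1 else 0) + (if l = j then 1 else 0)))"
    by (intro sum_mono PP_exp)
  also have "\<dots> = 5 * B * real n ^ 3"
    by (simp add: sum_distrib_left[symmetric] sum.distrib sum_distrib_right[symmetric] power3_eq_cube if_distrib[of "\<lambda>x. _ * x"] cong: if_cong)
  finally show ?le
    unfolding P_def .
qed

text \<open>Chebyshev: the normalised sum has second moment at most \<open>5 * B / n\<close>, so the
  tail is at most \<open>5 * B / (n * (a n)\<^sup>2)\<close>.\<close>

lemma (in prob_space) V_statistic_tendsto_0_in_prob: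
  fixes D :: "nat \<Rightarrow> 'a \<Rightarrow> 'd" and \<psi> :: "'d \<Rightarrow> 'd \<Rightarrow> real"
  assumes indep: "indep_vars (\<lambda>_. S) D UNIV"
    and meas: "(\<lambda>(d, d'). \<psi> d d') \<in> borel_measurable (S \<Otimes>\<^sub>M S)"
    and bound: "\<And>d d'. \<bar>\<psi> d d'\<bar> \<le> b d"
    and b_meas: "b \<in> borel_measurable S"
    and int: "\<And>i. integrable M (\<lambda>\<omega>. (b (D i \<omega>))\<^sup>2)"
    and B: "\<And>i. expectation (\<lambda>\<omega>. (b (D i \<omega>))\<^sup>2) \<le> B"
    and centred: "\<And>i j. i \<noteq> j \<Longrightarrow> expectation (\<lambda>\<omega>. \<psi> (D i \<omega>) (D j \<omega>)) = 0"
    and a_pos: "\<And>n. n \<ge> 1 \<Longrightarrow> a n > 0"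
    and a_rate: "filterlim (\<lambda>n. sqrt (real n) * a n) at_top sequentially"
  shows "(\<lambda>n. prob {\<omega> \<in> space M. a n \<le> \<bar>(\<Sum>i<n. \<Sum>j<n. \<psi> (D i \<omega>) (D j \<omega>)) / (real n)\<^sup>2\<bar>}) \<longlonglongrightarrow> 0"
proof (rule tendsto_sandwich[where f = "\<lambda>_. 0"])
  note moment = V_statistic_second_moment[OF indep meas bound b_meas int B centred]
  show "\<forall>\<^sub>F n in sequentially. prob {\<omega> \<in> space M. a n \<le> \<bar>(\<Sum>i<n. \<Sum>j<n. \<psi> (D i \<omega>) (D j \<omega>)) / (real n)\<^sup>2\<bar>}
      \<le> 5 * B / (sqrt (real n) * a n)\<^sup>2"
    using eventually_ge_at_top[of 1]
  proof eventually_elim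
    case (elim n)
    let ?S = "\<lambda>\<omega>. \<Sum>i<n. \<Sum>j<n. \<psi> (D i \<omega>) (D j \<omega>)"
    define t where "t = (a n * (real n)\<^sup>2)\<^sup>2"
    have t: "t > 0"
      using elim less_imp_neq[OF a_pos[OF elim]] by (simp add: t_def)
    have "{\<omega> \<in> space M. a n \<le> \<bar>?S \<omega> / (real n)\<^sup>2\<bar>} = {\<omega> \<in> space M. t \<le> (?S \<omega>)\<^sup>2}"
    proof -
      have "a n \<le> \<bar>?S \<omega> / (real n)\<^sup>2\<bar> \<longleftrightarrow> t \<le> (?S \<omega>)\<^sup>2" for \<omega>
      proof -
        have "a n \<le> \<bar>?S \<omega> / (real n)\<^sup>2\<bar> \<longleftrightarrow> a n * (real n)\<^sup>2 \<le> \<bar>?S \<omega>\<bar>"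
          using elim by (simp add: pos_le_divide_eq)
        also have "\<dots> \<longleftrightarrow> \<bar>a n * (real n)\<^sup>2\<bar> \<le> \<bar>?S \<omega>\<bar>"
          using a_pos[OF elim] by simp
        also have "\<dots> \<longleftrightarrow> t \<le> (?S \<omega>)\<^sup>2"
          unfolding t_def by (rule abs_le_square_iff)
        finally show ?thesis .
      qed
      then show ?thesis
        by auto
    qed
    moreover have "prob {\<omega> \<in> space M. t \<le> (?S \<omega>)\<^sup>2} \<le> expectation (\<lambda>\<omega>. (?S \<omega>)\<^sup>2) / t"
      by (rule integral_Markov_inequality_measure[OF moment(1) sets.top]) (use t in auto)
    moreover have "\<dots> \<le> 5 * B * real n ^ 3 / t"
      using moment(2)[of n] t by (intro divide_right_mono) auto
    moreover have "\<dots> = 5 * B / (sqrt (real n) * a n)\<^sup>2"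
      using elim less_imp_neq[OF a_pos[OF elim]] by (simp add: t_def power_mult_distrib field_simps power2_eq_square power3_eq_cube)
    ultimately show ?case
      by simp
  qed
  have "filterlim (\<lambda>n. (sqrt (real n) * a n)\<^sup>2) at_top sequentially"
    by (rule filterlim_pow_at_top[OF _ a_rate]) simp
  then show "(\<lambda>n. 5 * B / (sqrt (real n) * a n)\<^sup>2) \<longlonglongrightarrow> 0"
    by (rule tendsto_divide_0[OF tendsto_const filterlim_at_top_imp_at_infinity])
qed auto

subsection \<open>Conditional linearity and covariance with increasing functions\<close>

text \<open>Rewrites independence as a product law, ready for Fubini. On a rectangle it is the
  product rule for preimages in the two generated sigma-algebras, and rectangles determine the
  law.\<close>

lemma (in prob_space) indep_elements_distr:
  assumes "indep_elements M A U B V"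
  shows "distr M (A \<Otimes>\<^sub>M B) (\<lambda>\<omega>. (U \<omega>, V \<omega>)) = distr M A U \<Otimes>\<^sub>M distr M B V"
proof (rule pair_measure_eqI[symmetric])
  have meas [measurable]: "U \<in> measurable M A" "V \<in> measurable M B"
    and ind: "indep_set (sets (sigma_of M U A)) (sets (sigma_of M V B))"
    using assms unfolding indep_elements_def by auto
  show "sigma_finite_measure (distr M A U)" "sigma_finite_measure (distr M B V)"
    by (auto intro!: prob_space_imp_sigma_finite prob_space_distr)
  show "sets (distr M A U \<Otimes>\<^sub>M distr M B V) = sets (distr M (A \<Otimes>\<^sub>M B) (\<lambda>\<omega>. (U \<omega>, V \<omega>)))"
    by (simp cong: sets_pair_measure_cong)
  fix a b assume "a \<in> sets (distr M A U)" "b \<in> sets (distr M B V)"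
  then have ab [measurable]: "a \<in> sets A" "b \<in> sets B"
    by auto
  have "prob (U -` a \<inter> space M \<inter> (V -` b \<inter> space M)) = prob (U -` a \<inter> space M) * prob (V -` b \<inter> space M)"
    using ind ab unfolding sigma_of_def by (intro indep_setD[OF ind]) (auto simp: sigma_of_def intro: in_vimage_algebra)
  moreover have "(\<lambda>\<omega>. (U \<omega>, V \<omega>)) -` (a \<times> b) \<inter> space M = U -` a \<inter> space M \<inter> (V -` b \<inter> space M)"
    by auto
  ultimately show "emeasure (distr M A U) a * emeasure (distr M B V) b
      = emeasure (distr M (A \<Otimes>\<^sub>M B) (\<lambda>\<omega>. (U \<omega>, V \<omega>))) (a \<times> b)"
    by (simp add: emeasure_distr emeasure_eq_measure ennreal_mult)
qed

text \<open>Fubini with \<open>V\<close> frozen. The product law is taken as the hypothesis so that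
  the lemma serves both for two observations and for a predictor with its noise.\<close>

lemma (in prob_space) expectation_iterated:
  fixes f :: "'b \<Rightarrow> 'c \<Rightarrow> real"
  assumes [measurable]: "U \<in> measurable M A" "V \<in> measurable M B"
    and prod: "distr M (A \<Otimes>\<^sub>M B) (\<lambda>\<omega>. (U \<omega>, V \<omega>)) = distr M A U \<Otimes>\<^sub>M distr M B V"
    and f [measurable]: "(\<lambda>(u, v). f u v) \<in> borel_measurable (A \<Otimes>\<^sub>M B)"
    and int: "integrable M (\<lambda>\<omega>. f (U \<omega>) (V \<omega>))"
  shows "expectation (\<lambda>\<omega>. f (U \<omega>) (V \<omega>)) = (\<integral>v. expectation (\<lambda>\<omega>. f (U \<omega>) v) \<partial>distr M B V)" (is ?eq)
    and "integrable (distr M B V) (\<lambda>v. expectation (\<lambda>\<omega>. f (U \<omega>) v))" (is ?int)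
proof -
  interpret U: prob_space "distr M A U"
    by (rule prob_space_distr) simp
  interpret V: prob_space "distr M B V"
    by (rule prob_space_distr) simp
  interpret UV: pair_prob_space "distr M A U" "distr M B V" ..
  have int': "integrable (distr M A U \<Otimes>\<^sub>M distr M B V) (\<lambda>(u, v). f u v)"
    unfolding prod[symmetric] using int by (subst integrable_distr_eq) (auto simp: case_prod_beta)
  have inner: "(\<integral>u. f u v \<partial>distr M A U) = expectation (\<lambda>\<omega>. f (U \<omega>) v)" if "v \<in> space B" for v
    using that by (intro integral_distr) (auto intro: measurable_Pair2[OF f, unfolded split])
  have "expectation (\<lambda>\<omega>. f (U \<omega>) (V \<omega>)) = integral\<^sup>L (distr M A U \<Otimes>\<^sub>M distr M B V) (\<lambda>(u, v). f u v)"
    unfolding prod[symmetric] by (subst integral_distr) (auto simp: case_prod_beta)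
  also have "\<dots> = (\<integral>v. \<integral>u. f u v \<partial>distr M A U \<partial>distr M B V)"
    using UV.integral_snd[OF int'] by simp
  also have "\<dots> = (\<integral>v. expectation (\<lambda>\<omega>. f (U \<omega>) v) \<partial>distr M B V)"
    by (intro Bochner_Integration.integral_cong) (auto simp: inner)
  finally show ?eq .
  show ?int
    using UV.integrable_snd[OF int']
    by (rule Bochner_Integration.integrable_cong[THEN iffD1, rotated -1]) (auto simp: inner)
qed

text \<open>The factor \<open>h (Z \<omega>)\<close> is measurable for the sigma-algebra of
  \<open>Z\<close>, so \<open>W\<close> may be replaced by its conditional expectation under the
  integral.\<close>

lemma (in prob_space) integral_linear_cond_exp:
  assumes [measurable]: "Z \<in> borel_measurable M" "W \<in> borel_measurable M" "h \<in> borel_measurable borel"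
    and lin: "AE \<omega> in M. real_cond_exp M (sigma_of M Z borel) W \<omega> = d * Z \<omega>"
    and int: "integrable M (\<lambda>\<omega>. h (Z \<omega>) * W \<omega>)"
  shows "expectation (\<lambda>\<omega>. h (Z \<omega>) * W \<omega>) = d * expectation (\<lambda>\<omega>. h (Z \<omega>) * Z \<omega>)"
proof -
  have sub: "subalgebra M (sigma_of M Z borel)"
    unfolding subalgebra_def sigma_of_def
    using measurable_sets[OF assms(1)] by (auto simp: sets_vimage_algebra2)
  interpret sigma_finite_subalgebra M "sigma_of M Z borel"
    using sub by (intro finite_measure_subalgebra_is_sigma_finite finite_measure_subalgebra.intro
        finite_measure_subalgebra_axioms.intro finite_measure_axioms)
  have Z: "Z \<in> borel_measurable (sigma_of M Z borel)"
    unfolding sigma_of_def by (rule measurable_vimage_algebra1) simp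
  have "expectation (\<lambda>\<omega>. h (Z \<omega>) * W \<omega>)
      = expectation (\<lambda>\<omega>. h (Z \<omega>) * real_cond_exp M (sigma_of M Z borel) W \<omega>)"
    by (rule real_cond_exp_intg(2)[symmetric, OF int])
      (use measurable_compose[OF Z assms(3)] in auto)
  also have "\<dots> = expectation (\<lambda>\<omega>. d * (h (Z \<omega>) * Z \<omega>))"
    using lin by (intro integral_cong_AE) (auto simp: borel_measurable_cond_exp2)
  finally show ?thesis
    by simp
qed

text \<open>Since \<open>Z\<close> has mean zero, \<open>h\<close> may be replaced by
  \<open>h - h 0\<close>. The integrand is then positive wherever \<open>Z\<close> is nonzero, and
  the nonzero second moment makes that set non-null.\<close>

lemma (in prob_space) strict_mono_covariance_pos:
  fixes h :: "real \<Rightarrow> real"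
  assumes Z [measurable]: "Z \<in> borel_measurable M" "integrable M Z" "expectation Z = 0"
    and Z_nz: "expectation (\<lambda>\<omega>. (Z \<omega>)\<^sup>2) \<noteq> 0"
    and h: "strict_mono h" "\<And>u. \<bar>h u\<bar> \<le> c"
  shows "0 < expectation (\<lambda>\<omega>. h (Z \<omega>) * Z \<omega>)"
proof -
  have [measurable]: "h \<in> borel_measurable borel"
    using h(1) by (intro borel_measurable_mono strict_mono_mono)
  have int: "integrable M (\<lambda>\<omega>. h (Z \<omega>) * Z \<omega>)"
    by (rule Bochner_Integration.integrable_bound[of _ "\<lambda>\<omega>. c * Z \<omega>"])
      (use Z h(2) in \<open>auto simp: abs_mult intro!: AE_I2 mult_right_mono intro: order_trans[OF _ abs_ge_self]\<close>)
  have "(\<integral>\<omega>. 0 \<partial>M) < expectation (\<lambda>\<omega>. (h (Z \<omega>) - h 0) * Z \<omega>)"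
  proof (rule integral_less_AE)
    have pos: "0 < (h u - h 0) * u" if "u \<noteq> 0" for u
      using strict_monoD[OF h(1), of 0 u] strict_monoD[OF h(1), of u 0] that
      by (cases "0 < u") (auto simp: zero_less_mult_iff)
    show "integrable M (\<lambda>\<omega>. (h (Z \<omega>) - h 0) * Z \<omega>)"
      using int Z by (simp add: left_diff_distrib)
    show "AE \<omega> in M. \<omega> \<in> {\<omega> \<in> space M. Z \<omega> \<noteq> 0} \<longrightarrow> 0 \<noteq> (h (Z \<omega>) - h 0) * Z \<omega>"
      using less_imp_neq[OF pos] by (intro AE_I2) blast
    show "AE \<omega> in M. 0 \<le> (h (Z \<omega>) - h 0) * Z \<omega>"
      using pos by (intro AE_I2) (metis less_eq_real_def mult_zero_right)
    show "emeasure M {\<omega> \<in> space M. Z \<omega> \<noteq> 0} \<noteq> 0"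
    proof
      assume "emeasure M {\<omega> \<in> space M. Z \<omega> \<noteq> 0} = 0"
      then have "AE \<omega> in M. Z \<omega> = 0"
        by (intro AE_I[of _ _ "{\<omega> \<in> space M. Z \<omega> \<noteq> 0}"]) auto
      then have "expectation (\<lambda>\<omega>. (Z \<omega>)\<^sup>2) = expectation (\<lambda>\<omega>. 0)"
        by (intro integral_cong_AE) auto
      with Z_nz show False
        by simp
    qed
  qed auto
  also have "\<dots> = expectation (\<lambda>\<omega>. h (Z \<omega>) * Z \<omega>)"
    using int Z by (simp add: left_diff_distrib)
  finally show ?thesis
    by simp
qed

subsection \<open>The single index model\<close>

lemma borel_measurable_vec_nth [measurable (raw)]:
  fixes f :: "'a \<Rightarrow> real ^ 'n"
  assumes "f \<in> borel_measurable M"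
  shows "(\<lambda>x. f x $ j) \<in> borel_measurable M"
  using assms by (simp add: cart_eq_inner_axis)

lemma le_one_plus_square: "t \<le> 1 + t\<^sup>2" for t :: real
proof -
  have "t \<le> t\<^sup>2 + 1 / 4"
    using zero_le_power2[of "t - 1 / 2"] by (simp add: power2_eq_square algebra_simps)
  then show ?thesis
    by linarith
qed

text \<open>Coordinates are indexed by an arbitrary finite type here; the split into blocks enters
  only at the selection step. The condition \<open>\<beta> \<noteq> 0\<close> is what a nonempty
  support supplies.\<close>

locale single_index_model = prob_space M
  for M :: "'w measure" +
  fixes N :: "'e measure"
    and X :: "nat \<Rightarrow> 'w \<Rightarrow> real ^ 'p"
    and \<epsilon> :: "nat \<Rightarrow> 'w \<Rightarrow> 'e"
    and g :: "real \<Rightarrow> 'e \<Rightarrow> real"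
    and \<beta> :: "real ^ 'p"
  assumes X_meas [measurable]: "\<And>i. X i \<in> borel_measurable M"
    and eps_meas [measurable]: "\<And>i. \<epsilon> i \<in> measurable M N"
    and g_meas [measurable]: "(\<lambda>(u, e). g u e) \<in> borel_measurable (borel \<Otimes>\<^sub>M N)"
    and indep: "indep_vars (\<lambda>_. borel \<Otimes>\<^sub>M N) (\<lambda>i \<omega>. (X i \<omega>, \<epsilon> i \<omega>)) UNIV"
    and ident_distr: "\<And>i. distr M (borel \<Otimes>\<^sub>M N) (\<lambda>\<omega>. (X i \<omega>, \<epsilon> i \<omega>))
                         = distr M (borel \<Otimes>\<^sub>M N) (\<lambda>\<omega>. (X 0 \<omega>, \<epsilon> 0 \<omega>))"
    and X_eps_indep: "indep_elements M borel (X 0) N (\<epsilon> 0)"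
    and X_mean: "integrable M (X 0)" "expectation (X 0) = 0"
    and fourth_moment: "integrable M (\<lambda>\<omega>. norm (X 0 \<omega>) ^ 4)"
    and pos_def: "positive_definite (second_moment M (X 0))"
    and link: "\<beta> \<noteq> 0"
    and linearity: "\<And>\<theta>. \<exists>d. AE \<omega> in M.
      real_cond_exp M (sigma_of M (\<lambda>\<omega>. \<beta> \<bullet> X 0 \<omega>) borel) (\<lambda>\<omega>. \<theta> \<bullet> X 0 \<omega>) \<omega> = d * (\<beta> \<bullet> X 0 \<omega>)"
    and F_increasing: "strict_mono (cdf (distr M borel (response g \<beta> X \<epsilon> 0)))"
    and g_increasing: "\<And>e. e \<in> space N \<Longrightarrow> strict_mono (\<lambda>u. g u e)"
begin

abbreviation S :: "((real ^ 'p) \<times> 'e) measure"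
  where "S \<equiv> borel \<Otimes>\<^sub>M N"

abbreviation D :: "nat \<Rightarrow> 'w \<Rightarrow> (real ^ 'p) \<times> 'e"
  where "D i \<omega> \<equiv> (X i \<omega>, \<epsilon> i \<omega>)"

definition resp :: "(real ^ 'p) \<times> 'e \<Rightarrow> real"
  where "resp d = g (\<beta> \<bullet> fst d) (snd d)"

abbreviation Y :: "nat \<Rightarrow> 'w \<Rightarrow> real"
  where "Y \<equiv> response g \<beta> X \<epsilon>"

abbreviation H :: "real ^ 'p ^ 'p"
  where "H \<equiv> second_moment M (X 0)"

lemma g_measurable [measurable (raw)]:
  assumes "u \<in> borel_measurable L" "e \<in> measurable L N"
  shows "(\<lambda>x. g (u x) (e x)) \<in> borel_measurable L"
  using measurable_compose[OF measurable_Pair[OF assms] g_meas] by simp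

lemma resp_measurable [measurable]: "resp \<in> borel_measurable S"
  unfolding resp_def by measurable

lemma Y_eq: "Y i \<omega> = resp (D i \<omega>)"
  by (simp add: response_def resp_def)

lemma Y_measurable [measurable]: "Y i \<in> borel_measurable M"
  unfolding response_def by measurable

lemma ident_integral:
  fixes f :: "(real ^ 'p) \<times> 'e \<Rightarrow> real"
  assumes [measurable]: "f \<in> borel_measurable S"
  shows "expectation (\<lambda>\<omega>. f (D i \<omega>)) = expectation (\<lambda>\<omega>. f (D 0 \<omega>))"
    and "integrable M (\<lambda>\<omega>. f (D i \<omega>)) \<longleftrightarrow> integrable M (\<lambda>\<omega>. f (D 0 \<omega>))"
proof -
  have "expectation (\<lambda>\<omega>. f (D j \<omega>)) = integral\<^sup>L (distr M S (D j)) f" for j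
    by (rule integral_distr[symmetric]) measurable
  then show "expectation (\<lambda>\<omega>. f (D i \<omega>)) = expectation (\<lambda>\<omega>. f (D 0 \<omega>))"
    using ident_distr[of i] by simp
  have "integrable M (\<lambda>\<omega>. f (D j \<omega>)) \<longleftrightarrow> integrable (distr M S (D j)) f" for j
    by (rule integrable_distr_eq[symmetric]) measurable
  then show "integrable M (\<lambda>\<omega>. f (D i \<omega>)) \<longleftrightarrow> integrable M (\<lambda>\<omega>. f (D 0 \<omega>))"
    using ident_distr[of i] by simp
qed

lemma pair_distr:
  assumes "i \<noteq> j"
  shows "distr M (S \<Otimes>\<^sub>M S) (\<lambda>\<omega>. (D i \<omega>, D j \<omega>)) = distr M S (D i) \<Otimes>\<^sub>M distr M S (D j)"
proof -
  have "indep_var S ((\<lambda>f. f i) \<circ> (\<lambda>\<omega>. restrict (\<lambda>i. D i \<omega>) {i})) S ((\<lambda>f. f j) \<circ> (\<lambda>\<omega>. restrict (\<lambda>i. D i \<omega>) {j}))"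
    by (rule indep_var_compose[OF indep_var_restrict[OF indep]]) (use assms in auto)
  then have "indep_var S (D i) S (D j)"
    by (simp add: o_def)
  then show ?thesis
    unfolding indep_var_distribution_eq by simp
qed

text \<open>All pairs of distinct observations share one law, so centring of a kernel has to be
  checked for the pair 0, 1 only.\<close>

lemma pair_integral:
  fixes f :: "(real ^ 'p) \<times> 'e \<Rightarrow> (real ^ 'p) \<times> 'e \<Rightarrow> real"
  assumes "i \<noteq> j" and [measurable]: "(\<lambda>(d, d'). f d d') \<in> borel_measurable (S \<Otimes>\<^sub>M S)"
  shows "expectation (\<lambda>\<omega>. f (D i \<omega>) (D j \<omega>)) = expectation (\<lambda>\<omega>. f (D 0 \<omega>) (D 1 \<omega>))"
proof -
  have "expectation (\<lambda>\<omega>. f (D k \<omega>) (D l \<omega>))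
      = integral\<^sup>L (distr M (S \<Otimes>\<^sub>M S) (\<lambda>\<omega>. (D k \<omega>, D l \<omega>))) (\<lambda>(d, d'). f d d')" for k l
    by (subst integral_distr) (auto simp: case_prod_beta)
  then show ?thesis
    using pair_distr[OF assms(1)] pair_distr[of 0 1] ident_distr[of i] ident_distr[of j] ident_distr[of 1]
    by simp
qed

section \<open>Moments of the predictors\<close>

lemma norm_power2_integrable [simp]: "integrable M (\<lambda>\<omega>. (norm (X 0 \<omega>))\<^sup>2)"
proof (rule Bochner_Integration.integrable_bound)
  show "integrable M (\<lambda>\<omega>. 1 + norm (X 0 \<omega>) ^ 4)"
    using fourth_moment by simp
  have "t\<^sup>2 \<le> 1 + t ^ 4" for t :: real
  proof -
    have "2 * t\<^sup>2 \<le> t ^ 4 + 1"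
      using zero_le_power2[of "t\<^sup>2 - 1"] by (simp add: power2_diff)
    then show ?thesis
      using zero_le_power2[of t] by linarith
  qed
  then show "AE \<omega> in M. norm ((norm (X 0 \<omega>))\<^sup>2) \<le> norm (1 + norm (X 0 \<omega>) ^ 4)"
    by (auto simp: add_nonneg_nonneg)
qed measurable

lemma inner_integrable [simp]: "integrable M (\<lambda>\<omega>. u \<bullet> X 0 \<omega>)"
  using X_mean(1) by simp

lemma inner_expectation [simp]: "expectation (\<lambda>\<omega>. u \<bullet> X 0 \<omega>) = 0"
  using X_mean by simp

lemma inner_mult_integrable [simp]: "integrable M (\<lambda>\<omega>. (u \<bullet> X 0 \<omega>) * (v \<bullet> X 0 \<omega>))"
proof (rule Bochner_Integration.integrable_bound)
  show "integrable M (\<lambda>\<omega>. norm u * norm v * (norm (X 0 \<omega>))\<^sup>2)"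
    by simp
  have "\<bar>(u \<bullet> x) * (v \<bullet> x)\<bar> \<le> norm u * norm v * (norm x)\<^sup>2" for x
  proof -
    have "\<bar>(u \<bullet> x) * (v \<bullet> x)\<bar> \<le> (norm u * norm x) * (norm v * norm x)"
      unfolding abs_mult by (intro mult_mono Cauchy_Schwarz_ineq2) auto
    then show ?thesis
      by (simp add: power2_eq_square ac_simps)
  qed
  then show "AE \<omega> in M. norm ((u \<bullet> X 0 \<omega>) * (v \<bullet> X 0 \<omega>)) \<le> norm (norm u * norm v * (norm (X 0 \<omega>))\<^sup>2)"
    by (auto simp: abs_mult)
qed measurable

lemma second_moment_inner: "u \<bullet> (H *v v) = expectation (\<lambda>\<omega>. (u \<bullet> X 0 \<omega>) * (v \<bullet> X 0 \<omega>))"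
proof -
  have int: "integrable M (\<lambda>\<omega>. X 0 \<omega> $ j * X 0 \<omega> $ k)" for j k
    using inner_mult_integrable[of "axis j 1" "axis k 1"] by (simp add: inner_axis')
  have "(\<lambda>\<omega>. (u \<bullet> X 0 \<omega>) * (v \<bullet> X 0 \<omega>))
      = (\<lambda>\<omega>. \<Sum>j\<in>UNIV. \<Sum>k\<in>UNIV. u $ j * (v $ k * (X 0 \<omega> $ j * X 0 \<omega> $ k)))"
    by (simp add: inner_vec_def sum_product ac_simps)
  then have "expectation (\<lambda>\<omega>. (u \<bullet> X 0 \<omega>) * (v \<bullet> X 0 \<omega>))
      = (\<Sum>j\<in>UNIV. \<Sum>k\<in>UNIV. u $ j * (v $ k * expectation (\<lambda>\<omega>. X 0 \<omega> $ j * X 0 \<omega> $ k)))"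
    using int by (simp add: Bochner_Integration.integral_sum)
  also have "\<dots> = u \<bullet> (H *v v)"
    by (simp add: second_moment_def matrix_vector_mult_def inner_vec_def sum_distrib_left ac_simps)
  finally show ?thesis
    by simp
qed

lemma bounded_mult_inner_integrable:
  assumes [measurable]: "h \<in> borel_measurable M" and h: "\<And>\<omega>. \<bar>h \<omega>\<bar> \<le> (1 :: real)"
  shows "integrable M (\<lambda>\<omega>. h \<omega> * (u \<bullet> X 0 \<omega>))"
  by (rule Bochner_Integration.integrable_bound[of _ "\<lambda>\<omega>. u \<bullet> X 0 \<omega>"])
    (use h in \<open>auto simp: abs_mult intro!: mult_left_le_one_le\<close>)

lemma mu_inner: "u \<bullet> mu_vec M X Y = expectation (\<lambda>\<omega>. of_bool (Y 1 \<omega> \<le> Y 0 \<omega>) * (u \<bullet> X 0 \<omega>))"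
proof -
  have "integrable M (\<lambda>\<omega>. of_bool (Y 1 \<omega> \<le> Y 0 \<omega>) *\<^sub>R X 0 \<omega>)"
    by (rule Bochner_Integration.integrable_bound[OF X_mean(1)]) auto
  then show ?thesis
    unfolding mu_vec_def by (subst integral_inner_right[symmetric]) auto
qed

section \<open>The direction of the population parameter\<close>

definition F :: "real \<Rightarrow> real"
  where "F = cdf (distr M borel (Y 0))"

lemma F_strict_mono: "strict_mono F"
  unfolding F_def by (rule F_increasing)

lemma F_bounded: "\<bar>F y\<bar> \<le> 1"
proof -
  interpret Y0: prob_space "distr M borel (Y 0)"
    by (rule prob_space_distr) simp
  show ?thesis
    by (simp add: F_def cdf_def)
qed

lemma F_measurable [measurable]: "F \<in> borel_measurable borel"
  by (intro borel_measurable_mono strict_mono_mono F_strict_mono)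

text \<open>Averaging over observation 1 with observation 0 frozen turns the indicator into the
  distribution function at the response.\<close>

lemma mu_inner_F: "u \<bullet> mu_vec M X Y = expectation (\<lambda>\<omega>. F (Y 0 \<omega>) * (u \<bullet> X 0 \<omega>))"
proof -
  define f where "f d' d = of_bool (resp d' \<le> resp d) * (u \<bullet> fst d)" for d' d :: "(real ^ 'p) \<times> 'e"
  have f_meas: "(\<lambda>(d', d). f d' d) \<in> borel_measurable (S \<Otimes>\<^sub>M S)"
    unfolding f_def by measurable
  have inner: "expectation (\<lambda>\<omega>. f (D 1 \<omega>) d) = F (resp d) * (u \<bullet> fst d)" for d
  proof -
    \<comment> \<open>\<open>F\<close> is defined through \<open>Y 0\<close>, so the law of
      observation 1 is first exchanged for that of observation 0.\<close>
    have "expectation (\<lambda>\<omega>. of_bool (resp (D 1 \<omega>) \<le> resp d)) = expectation (\<lambda>\<omega>. of_bool (resp (D 0 \<omega>) \<le> resp d) :: real)"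
      by (rule ident_integral(1)[of "\<lambda>d'. of_bool (resp d' \<le> resp d)"]) measurable
    also have "\<dots> = expectation (indicator {\<omega> \<in> space M. Y 0 \<omega> \<le> resp d})"
      by (intro Bochner_Integration.integral_cong) (auto simp: Y_eq indicator_def)
    also have "\<dots> = F (resp d)"
      by (simp add: F_def cdf_def measure_distr vimage_def Int_def conj_commute)
    finally show ?thesis
      by (simp add: f_def)
  qed
  have "u \<bullet> mu_vec M X Y = expectation (\<lambda>\<omega>. f (D 1 \<omega>) (D 0 \<omega>))"
    unfolding mu_inner f_def Y_eq by simp
  also have "\<dots> = (\<integral>d. expectation (\<lambda>\<omega>. f (D 1 \<omega>) d) \<partial>distr M S (D 0))"
  proof (rule expectation_iterated(1)[OF _ _ pair_distr f_meas])
    show "integrable M (\<lambda>\<omega>. f (D 1 \<omega>) (D 0 \<omega>))"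
      unfolding f_def fst_conv by (rule bounded_mult_inner_integrable) auto
  qed auto
  also have "\<dots> = expectation (\<lambda>\<omega>. F (resp (D 0 \<omega>)) * (u \<bullet> fst (D 0 \<omega>)))"
    unfolding inner by (rule integral_distr) measurable
  finally show ?thesis
    by (simp add: Y_eq)
qed

text \<open>With the noise frozen, the weight is a function of
  \<open>\<beta> \<bullet> X 0 \<omega>\<close> alone, as conditional linearity and the covariance
  inequality require.\<close>

lemma mu_inner_eps:
  shows "u \<bullet> mu_vec M X Y
      = (\<integral>e. expectation (\<lambda>\<omega>. F (g (\<beta> \<bullet> X 0 \<omega>) e) * (u \<bullet> X 0 \<omega>)) \<partial>distr M N (\<epsilon> 0))"
    and "integrable (distr M N (\<epsilon> 0)) (\<lambda>e. expectation (\<lambda>\<omega>. F (g (\<beta> \<bullet> X 0 \<omega>) e) * (u \<bullet> X 0 \<omega>)))"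
proof -
  have "integrable M (\<lambda>\<omega>. F (g (\<beta> \<bullet> X 0 \<omega>) (\<epsilon> 0 \<omega>)) * (u \<bullet> X 0 \<omega>))"
    by (rule bounded_mult_inner_integrable) (measurable, rule F_bounded)
  note iter = expectation_iterated[OF X_meas eps_meas indep_elements_distr[OF X_eps_indep] _ this]
  show "u \<bullet> mu_vec M X Y
      = (\<integral>e. expectation (\<lambda>\<omega>. F (g (\<beta> \<bullet> X 0 \<omega>) e) * (u \<bullet> X 0 \<omega>)) \<partial>distr M N (\<epsilon> 0))"
    unfolding mu_inner_F response_def by (rule iter(1)) measurable
  show "integrable (distr M N (\<epsilon> 0)) (\<lambda>e. expectation (\<lambda>\<omega>. F (g (\<beta> \<bullet> X 0 \<omega>) e) * (u \<bullet> X 0 \<omega>)))"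
    by (rule iter(2)) measurable
qed

text \<open>For each noise value the weight is bounded and strictly increasing in
  \<open>\<beta> \<bullet> X 0 \<omega>\<close>, a variable with mean zero and positive variance.
  Averaging over the noise keeps the inequality strict.\<close>

lemma mu_beta_pos: "0 < \<beta> \<bullet> mu_vec M X Y"
proof -
  interpret E: prob_space "distr M N (\<epsilon> 0)"
    by (rule prob_space_distr) simp
  have "expectation (\<lambda>\<omega>. (\<beta> \<bullet> X 0 \<omega>)\<^sup>2) \<noteq> 0"
    using pos_def link second_moment_inner[of \<beta> \<beta>]
    unfolding positive_definite_def by (metis (no_types, lifting) power2_eq_square less_irrefl Bochner_Integration.integral_cong)
  moreover have "strict_mono (\<lambda>u. F (g u e))" if "e \<in> space N" for e
    using F_strict_mono g_increasing[OF that] by (simp add: strict_mono_def)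
  ultimately have "0 < expectation (\<lambda>\<omega>. F (g (\<beta> \<bullet> X 0 \<omega>) e) * (\<beta> \<bullet> X 0 \<omega>))" if "e \<in> space N" for e
    using that F_bounded by (intro strict_mono_covariance_pos[where c = 1]) auto
  then have "(\<integral>e. 0 \<partial>distr M N (\<epsilon> 0))
      < (\<integral>e. expectation (\<lambda>\<omega>. F (g (\<beta> \<bullet> X 0 \<omega>) e) * (\<beta> \<bullet> X 0 \<omega>)) \<partial>distr M N (\<epsilon> 0))"
    using E.emeasure_space_1 by (intro E.integral_less_AE_space mu_inner_eps AE_I2) auto
  then show ?thesis
    by (simp add: mu_inner_eps(1)[of \<beta>])
qed

text \<open>Replacing \<open>\<beta>\<close> by \<open>u\<close> multiplies both pairings by the
  same factor \<open>d\<close> from conditional linearity; cross-multiplication eliminates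
  it.\<close>

lemma mu_linear: "(u \<bullet> mu_vec M X Y) * (\<beta> \<bullet> (H *v \<beta>)) = (u \<bullet> (H *v \<beta>)) * (\<beta> \<bullet> mu_vec M X Y)"
proof -
  obtain d where d: "AE \<omega> in M.
      real_cond_exp M (sigma_of M (\<lambda>\<omega>. \<beta> \<bullet> X 0 \<omega>) borel) (\<lambda>\<omega>. u \<bullet> X 0 \<omega>) \<omega> = d * (\<beta> \<bullet> X 0 \<omega>)"
    using linearity by blast
  have cond: "expectation (\<lambda>\<omega>. F (g (\<beta> \<bullet> X 0 \<omega>) e) * (u \<bullet> X 0 \<omega>))
      = d * expectation (\<lambda>\<omega>. F (g (\<beta> \<bullet> X 0 \<omega>) e) * (\<beta> \<bullet> X 0 \<omega>))" if [measurable]: "e \<in> space N" for e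
    by (rule integral_linear_cond_exp[OF _ _ _ d, of "\<lambda>t. F (g t e)"])
      (auto intro!: bounded_mult_inner_integrable F_bounded)
  have "u \<bullet> mu_vec M X Y
      = (\<integral>e. d * expectation (\<lambda>\<omega>. F (g (\<beta> \<bullet> X 0 \<omega>) e) * (\<beta> \<bullet> X 0 \<omega>)) \<partial>distr M N (\<epsilon> 0))"
    unfolding mu_inner_eps(1)[of u] by (intro Bochner_Integration.integral_cong) (simp_all add: cond)
  then have mu: "u \<bullet> mu_vec M X Y = d * (\<beta> \<bullet> mu_vec M X Y)"
    by (simp add: mu_inner_eps(1)[of \<beta>])
  \<comment> \<open>The identity in the role of \<open>h\<close> gives the same factor
    \<open>d\<close> for the covariance.\<close>
  have "expectation (\<lambda>\<omega>. (\<beta> \<bullet> X 0 \<omega>) * (u \<bullet> X 0 \<omega>)) = d * expectation (\<lambda>\<omega>. (\<beta> \<bullet> X 0 \<omega>) * (\<beta> \<bullet> X 0 \<omega>))"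
    by (rule integral_linear_cond_exp[OF _ _ _ d, of "\<lambda>t. t"]) auto
  then have "u \<bullet> (H *v \<beta>) = d * (\<beta> \<bullet> (H *v \<beta>))"
    unfolding second_moment_inner by (simp add: mult.commute)
  with mu show ?thesis
    by simp
qed

lemma theta_star_normal_eq: "H *v theta_star M X Y = mu_vec M X Y"
  unfolding theta_star_def
  using matrix_inv_mult(2)[OF positive_definite_invertible[OF pos_def]]
  by (simp add: matrix_vector_mul_assoc)

text \<open>By \<open>mu_linear\<close> the vector \<open>mu_vec M X Y\<close> is a multiple of
  \<open>H *v \<beta>\<close>, and \<open>H\<close> is injective. Since the multiple is nonzero,
  \<open>theta_star\<close> inherits the support of \<open>\<beta>\<close>.\<close>

lemma theta_star_proportional:
  obtains \<gamma> where "\<gamma> > 0" "theta_star M X Y = \<gamma> *\<^sub>R \<beta>"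
proof
  define \<gamma> where "\<gamma> = (\<beta> \<bullet> mu_vec M X Y) / (\<beta> \<bullet> (H *v \<beta>))"
  have pos: "0 < \<beta> \<bullet> (H *v \<beta>)"
    using pos_def link unfolding positive_definite_def by blast
  then show "\<gamma> > 0"
    using mu_beta_pos by (simp add: \<gamma>_def)
  have "u \<bullet> (H *v theta_star M X Y) = u \<bullet> (H *v (\<gamma> *\<^sub>R \<beta>))" for u
    using mu_linear[of u] pos
    by (simp add: theta_star_normal_eq matrix_vector_mult_scaleR \<gamma>_def field_simps)
  then have "H *v theta_star M X Y = H *v (\<gamma> *\<^sub>R \<beta>)"
    using vector_eq_ldot[of "H *v theta_star M X Y" "H *v (\<gamma> *\<^sub>R \<beta>)"] by blast
  then show "theta_star M X Y = \<gamma> *\<^sub>R \<beta>"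
    using inj_matrix_vector_mult[OF positive_definite_invertible[OF pos_def]] by (simp add: inj_eq)
qed

section \<open>Rates for the score and the Gram matrix\<close>

text \<open>An envelope quadratic in the predictor is square integrable by the fourth
  moment.\<close>

lemma V_statistic_rate:
  fixes \<psi> :: "(real ^ 'p) \<times> 'e \<Rightarrow> (real ^ 'p) \<times> 'e \<Rightarrow> real"
  assumes meas: "(\<lambda>(d, d'). \<psi> d d') \<in> borel_measurable (S \<Otimes>\<^sub>M S)"
    and bound: "\<And>d d'. \<bar>\<psi> d d'\<bar> \<le> C * (1 + (norm (fst d))\<^sup>2)"
    and centred: "expectation (\<lambda>\<omega>. \<psi> (D 0 \<omega>) (D 1 \<omega>)) = 0"
    and a: "\<And>n. n \<ge> 1 \<Longrightarrow> a n > 0" "filterlim (\<lambda>n. sqrt (real n) * a n) at_top sequentially"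
  shows "(\<lambda>n. prob {\<omega> \<in> space M. a n \<le> \<bar>(\<Sum>i<n. \<Sum>j<n. \<psi> (D i \<omega>) (D j \<omega>)) / (real n)\<^sup>2\<bar>}) \<longlonglongrightarrow> 0"
proof -
  define b where "b d = C * (1 + (norm (fst d))\<^sup>2)" for d :: "(real ^ 'p) \<times> 'e"
  have b_meas [measurable]: "b \<in> borel_measurable S"
    unfolding b_def by measurable
  have "(\<lambda>\<omega>. (b (D 0 \<omega>))\<^sup>2) = (\<lambda>\<omega>. C\<^sup>2 * (1 + 2 * (norm (X 0 \<omega>))\<^sup>2 + norm (X 0 \<omega>) ^ 4))"
    by (auto simp: b_def power2_eq_square power4_eq_xxxx algebra_simps)
  then have int: "integrable M (\<lambda>\<omega>. (b (D 0 \<omega>))\<^sup>2)"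
    using fourth_moment by simp
  have b2_meas: "(\<lambda>d. (b d)\<^sup>2) \<in> borel_measurable S"
    by measurable
  show ?thesis
  proof (rule V_statistic_tendsto_0_in_prob[OF indep meas bound[folded b_def] b_meas _ _ _ a])
    show "integrable M (\<lambda>\<omega>. (b (D i \<omega>))\<^sup>2)" for i
      using int ident_integral(2)[OF b2_meas] by blast
    show "expectation (\<lambda>\<omega>. (b (D i \<omega>))\<^sup>2) \<le> expectation (\<lambda>\<omega>. (b (D 0 \<omega>))\<^sup>2)" for i
      using ident_integral(1)[OF b2_meas, of i] by simp
    show "expectation (\<lambda>\<omega>. \<psi> (D i \<omega>) (D j \<omega>)) = 0" if "i \<noteq> j" for i j
      using pair_integral[OF that meas] centred by simp
  qed
qed

text \<open>A rank is itself a sum over the sample, diagonal term included, so the score averages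
  this kernel over all pairs.\<close>

definition score_kernel :: "'p \<Rightarrow> (real ^ 'p) \<times> 'e \<Rightarrow> (real ^ 'p) \<times> 'e \<Rightarrow> real"
  where "score_kernel k d d' = (of_bool (resp d' \<le> resp d) - 1 / 2 - theta_star M X Y \<bullet> fst d) * fst d $ k"

lemma score_eq_V_statistic:
  assumes "n \<ge> 1"
  shows "score n (\<lambda>i. X i \<omega>) (\<lambda>i. Y i \<omega>) (theta_star M X Y) $ k
    = (\<Sum>i<n. \<Sum>j<n. score_kernel k (D i \<omega>) (D j \<omega>)) / (real n)\<^sup>2"
proof -
  let ?r = "rank_in n (\<lambda>i. Y i \<omega>)" and ?t = "theta_star M X Y"
  have "score_kernel k (D i \<omega>) (D j \<omega>)
      = (of_bool (Y j \<omega> \<le> Y i \<omega>) - (1 / 2 + ?t \<bullet> X i \<omega>)) * X i \<omega> $ k" for i j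
    by (simp add: score_kernel_def Y_eq[of _ \<omega>] algebra_simps)
  then have "(\<Sum>j<n. score_kernel k (D i \<omega>) (D j \<omega>))
      = (?r i - real n * (1 / 2 + ?t \<bullet> X i \<omega>)) * X i \<omega> $ k" for i
    by (simp only: rank_in_def sum_distrib_right[symmetric] sum_subtractf) simp
  moreover have "(?r i - real n * (1 / 2 + ?t \<bullet> X i \<omega>)) * X i \<omega> $ k
      = real n * ((?r i / real n - 1 / 2 - ?t \<bullet> X i \<omega>) * X i \<omega> $ k)" for i
    using assms by (simp add: field_simps)
  ultimately show ?thesis
    using assms by (simp add: score_def sum_distrib_left[symmetric] power2_eq_square)
qed

text \<open>Off the diagonal the kernel is centred: the constant \<open>1 / 2\<close> drops out
  because the predictors have mean zero, and the rest cancels by the normal equations for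
  \<open>theta_star\<close>.\<close>

lemma score_rate:
  assumes "\<And>n. n \<ge> 1 \<Longrightarrow> a n > 0" "filterlim (\<lambda>n. sqrt (real n) * a n) at_top sequentially"
  shows "(\<lambda>n. prob {\<omega> \<in> space M.
    a n \<le> \<bar>score n (\<lambda>i. X i \<omega>) (\<lambda>i. Y i \<omega>) (theta_star M X Y) $ k\<bar>}) \<longlonglongrightarrow> 0"
proof -
  let ?t = "theta_star M X Y"
  have "(\<lambda>n. prob {\<omega> \<in> space M. a n \<le> \<bar>(\<Sum>i<n. \<Sum>j<n. score_kernel k (D i \<omega>) (D j \<omega>)) / (real n)\<^sup>2\<bar>}) \<longlonglongrightarrow> 0"
  proof (rule V_statistic_rate[OF _ _ _ assms])
    show "(\<lambda>(d, d'). score_kernel k d d') \<in> borel_measurable (S \<Otimes>\<^sub>M S)"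
      unfolding score_kernel_def by measurable
    show "\<bar>score_kernel k d d'\<bar> \<le> (3 / 2 + norm ?t) * (1 + (norm (fst d))\<^sup>2)" for d d'
    proof -
      let ?x = "norm (fst d)"
      have "\<bar>of_bool (resp d' \<le> resp d) - 1 / 2 - ?t \<bullet> fst d\<bar> \<le> 3 / 2 + norm ?t * ?x"
        using Cauchy_Schwarz_ineq2[of ?t "fst d"] by (cases "resp d' \<le> resp d") auto
      then have "\<bar>score_kernel k d d'\<bar> \<le> (3 / 2 + norm ?t * ?x) * ?x"
        unfolding score_kernel_def abs_mult by (intro mult_mono component_le_norm_cart) auto
      also have "\<dots> = 3 / 2 * ?x + norm ?t * ?x\<^sup>2"
        by (simp add: algebra_simps power2_eq_square)
      also have "\<dots> \<le> 3 / 2 * (1 + ?x\<^sup>2) + norm ?t * (1 + ?x\<^sup>2)"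
        by (intro add_mono mult_left_mono le_one_plus_square) auto
      finally show ?thesis
        by (simp add: algebra_simps)
    qed
    have "expectation (\<lambda>\<omega>. score_kernel k (D 0 \<omega>) (D 1 \<omega>))
        = expectation (\<lambda>\<omega>. of_bool (Y 1 \<omega> \<le> Y 0 \<omega>) * (axis k 1 \<bullet> X 0 \<omega>)
          - 1 / 2 * (axis k 1 \<bullet> X 0 \<omega>) - (axis k 1 \<bullet> X 0 \<omega>) * (?t \<bullet> X 0 \<omega>))"
      by (simp add: score_kernel_def Y_eq inner_axis' algebra_simps)
    also have "\<dots> = axis k 1 \<bullet> mu_vec M X Y - axis k 1 \<bullet> (H *v ?t)"
    proof -
      have "integrable M (\<lambda>\<omega>. of_bool (Y 1 \<omega> \<le> Y 0 \<omega>) * (axis k 1 \<bullet> X 0 \<omega>))"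
        by (rule bounded_mult_inner_integrable) auto
      then show ?thesis
        by (simp add: mu_inner second_moment_inner del: of_bool_eq_0_iff)
    qed
    also have "\<dots> = 0"
      by (simp add: theta_star_normal_eq)
    finally show "expectation (\<lambda>\<omega>. score_kernel k (D 0 \<omega>) (D 1 \<omega>)) = 0" .
  qed
  then show ?thesis
    by (rule Lim_transform_eventually)
      (use eventually_ge_at_top[of 1] in eventually_elim, simp add: score_eq_V_statistic)
qed

text \<open>An ordinary mean is a V-statistic whose kernel is constant in its second argument, the
  inner sum giving a factor \<open>n\<close>. A fixed threshold \<open>c\<close> satisfies the rate
  condition.\<close>

lemma gram_rate:
  assumes "c > 0"
  shows "(\<lambda>n. prob {\<omega> \<in> space M. c \<le> \<bar>gram n (\<lambda>i. X i \<omega>) $ j $ k - H $ j $ k\<bar>}) \<longlonglongrightarrow> 0"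
proof -
  define \<psi> where "\<psi> d d' = fst d $ j * fst d $ k - H $ j $ k" for d d' :: "(real ^ 'p) \<times> 'e"
  have "(\<lambda>n. prob {\<omega> \<in> space M. c \<le> \<bar>(\<Sum>i<n. \<Sum>j<n. \<psi> (D i \<omega>) (D j \<omega>)) / (real n)\<^sup>2\<bar>}) \<longlonglongrightarrow> 0"
  proof (rule V_statistic_rate)
    show "(\<lambda>(d, d'). \<psi> d d') \<in> borel_measurable (S \<Otimes>\<^sub>M S)"
      unfolding \<psi>_def by measurable
    show "\<bar>\<psi> d d'\<bar> \<le> (1 + \<bar>H $ j $ k\<bar>) * (1 + (norm (fst d))\<^sup>2)" for d d'
    proof -
      have "\<bar>fst d $ j * fst d $ k\<bar> \<le> norm (fst d) * norm (fst d)"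
        unfolding abs_mult by (intro mult_mono component_le_norm_cart) auto
      then have "\<bar>\<psi> d d'\<bar> \<le> (norm (fst d))\<^sup>2 + \<bar>H $ j $ k\<bar>"
        unfolding \<psi>_def power2_eq_square by linarith
      also have "\<dots> \<le> (1 + \<bar>H $ j $ k\<bar>) * (1 + (norm (fst d))\<^sup>2)"
        by (simp add: algebra_simps)
      finally show ?thesis .
    qed
    show "expectation (\<lambda>\<omega>. \<psi> (D 0 \<omega>) (D 1 \<omega>)) = 0"
    proof -
      have "integrable M (\<lambda>\<omega>. X 0 \<omega> $ j * X 0 \<omega> $ k)"
        using inner_mult_integrable[of "axis j 1" "axis k 1"] by (simp add: inner_axis')
      then show ?thesis
        by (simp add: \<psi>_def second_moment_def prob_space)
    qed
    show "filterlim (\<lambda>n. sqrt (real n) * c) at_top sequentially"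
      by (rule filterlim_at_top_mult_tendsto_pos[OF tendsto_const assms])
        (rule filterlim_compose[OF sqrt_at_top filterlim_real_sequentially])
  qed (use assms in simp)
  then show ?thesis
  proof (rule Lim_transform_eventually)
    show "\<forall>\<^sub>F n in sequentially. prob {\<omega> \<in> space M. c \<le> \<bar>(\<Sum>i<n. \<Sum>j<n. \<psi> (D i \<omega>) (D j \<omega>)) / (real n)\<^sup>2\<bar>}
        = prob {\<omega> \<in> space M. c \<le> \<bar>gram n (\<lambda>i. X i \<omega>) $ j $ k - H $ j $ k\<bar>}"
      using eventually_ge_at_top[of 1]
    proof eventually_elim
      case (elim n)
      then have "(\<Sum>i<n. \<Sum>j<n. \<psi> (D i \<omega>) (D j \<omega>)) / (real n)\<^sup>2
          = gram n (\<lambda>i. X i \<omega>) $ j $ k - H $ j $ k" for \<omega>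
        by (simp add: \<psi>_def gram_def sum_distrib_left[symmetric] sum_subtractf power2_eq_square field_simps)
      then show ?case
        by simp
    qed
  qed
qed

text \<open>The entrywise thresholds are divided by the dimension and its square, so that summing
  entries bounds the norm of the score by \<open>\<eta> * lam n\<close> and the operator norm of the
  Gram error by \<open>\<eta>\<close>.\<close>

definition good_event :: "real \<Rightarrow> (nat \<Rightarrow> real) \<Rightarrow> nat \<Rightarrow> 'w set"
  where "good_event \<eta> lam n = {\<omega> \<in> space M.
    (\<forall>k. \<bar>score n (\<lambda>i. X i \<omega>) (\<lambda>i. Y i \<omega>) (theta_star M X Y) $ k\<bar> < \<eta> / real CARD('p) * lam n) \<and>
    (\<forall>j k. \<bar>gram n (\<lambda>i. X i \<omega>) $ j $ k - H $ j $ k\<bar> < \<eta> / (real CARD('p))\<^sup>2)}"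

lemma score_measurable [measurable]:
  "(\<lambda>\<omega>. score n (\<lambda>i. X i \<omega>) (\<lambda>i. Y i \<omega>) \<theta> $ k) \<in> borel_measurable M"
  unfolding score_def rank_in_def vec_lambda_beta by measurable

lemma gram_measurable [measurable]:
  "(\<lambda>\<omega>. gram n (\<lambda>i. X i \<omega>) $ j $ k) \<in> borel_measurable M"
  unfolding gram_def vec_lambda_beta by measurable

lemma good_event_measurable: "good_event \<eta> lam n \<in> events"
  unfolding good_event_def by measurable

text \<open>A union bound over finitely many tail events, their number independent of
  \<open>n\<close>, each of vanishing probability.\<close>

lemma good_event_prob:
  assumes "\<eta> > 0" "\<And>n. n \<ge> 1 \<Longrightarrow> lam n > 0"
    "filterlim (\<lambda>n. sqrt (real n) * lam n) at_top sequentially"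
  shows "(\<lambda>n. prob (good_event \<eta> lam n)) \<longlonglongrightarrow> 1"
proof (rule tendsto_sandwich)
  let ?A = "\<lambda>n k. {\<omega> \<in> space M. \<eta> / real CARD('p) * lam n
    \<le> \<bar>score n (\<lambda>i. X i \<omega>) (\<lambda>i. Y i \<omega>) (theta_star M X Y) $ k\<bar>}"
  let ?B = "\<lambda>n j k. {\<omega> \<in> space M. \<eta> / (real CARD('p))\<^sup>2 \<le> \<bar>gram n (\<lambda>i. X i \<omega>) $ j $ k - H $ j $ k\<bar>}"
  have c: "0 < \<eta> / real CARD('p)"
    using assms(1) by simp
  have rate: "filterlim (\<lambda>n. (\<eta> / real CARD('p)) * (sqrt (real n) * lam n)) at_top sequentially"
    by (rule filterlim_tendsto_pos_mult_at_top[OF tendsto_const c assms(3)])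
  have A: "(\<lambda>n. prob (?A n k)) \<longlonglongrightarrow> 0" for k
  proof (rule score_rate)
    show "0 < \<eta> / real CARD('p) * lam n" if "n \<ge> 1" for n
      using c assms(2)[OF that] by (rule mult_pos_pos)
  qed (use rate in \<open>simp add: ac_simps\<close>)
  have B: "(\<lambda>n. prob (?B n j k)) \<longlonglongrightarrow> 0" for j k
    using assms(1) by (intro gram_rate) simp
  have "(\<lambda>n. (\<Sum>k\<in>UNIV. prob (?A n k)) + (\<Sum>j\<in>UNIV. \<Sum>k\<in>UNIV. prob (?B n j k))) \<longlonglongrightarrow> 0"
    by (intro tendsto_add_zero tendsto_null_sum A B)
  from tendsto_diff[OF tendsto_const[of 1] this]
  show "(\<lambda>n. 1 - ((\<Sum>k\<in>UNIV. prob (?A n k)) + (\<Sum>j\<in>UNIV. \<Sum>k\<in>UNIV. prob (?B n j k)))) \<longlonglongrightarrow> 1"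
    by simp
  show "\<forall>\<^sub>F n in sequentially. 1 - ((\<Sum>k\<in>UNIV. prob (?A n k)) + (\<Sum>j\<in>UNIV. \<Sum>k\<in>UNIV. prob (?B n j k)))
      \<le> prob (good_event \<eta> lam n)"
  proof (rule always_eventually, rule allI)
    fix n
    have [measurable]: "?A n k \<in> events" "?B n j k \<in> events" for j k
      by measurable
    have "1 - prob (good_event \<eta> lam n) = prob (space M - good_event \<eta> lam n)"
      by (rule prob_compl[symmetric, OF good_event_measurable])
    also have "\<dots> \<le> prob ((\<Union>k. ?A n k) \<union> (\<Union>j. \<Union>k. ?B n j k))"
      by (rule finite_measure_mono) (auto simp: good_event_def not_less)
    also have "\<dots> \<le> prob (\<Union>k. ?A n k) + prob (\<Union>j. \<Union>k. ?B n j k)"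
      by (rule measure_Un_le) auto
    also have "prob (\<Union>k. ?A n k) \<le> (\<Sum>k\<in>UNIV. prob (?A n k))"
      by (rule finite_measure_subadditive_finite) auto
    also have "prob (\<Union>j. \<Union>k. ?B n j k) \<le> (\<Sum>j\<in>UNIV. prob (\<Union>k. ?B n j k))"
      by (rule finite_measure_subadditive_finite) auto
    also have "\<dots> \<le> (\<Sum>j\<in>UNIV. \<Sum>k\<in>UNIV. prob (?B n j k))"
      by (intro sum_mono finite_measure_subadditive_finite) auto
    finally show "1 - ((\<Sum>k\<in>UNIV. prob (?A n k)) + (\<Sum>j\<in>UNIV. \<Sum>k\<in>UNIV. prob (?B n j k)))
      \<le> prob (good_event \<eta> lam n)"
      by simp
  qed
qed auto

lemma good_event_bounds:
  assumes "\<omega> \<in> good_event \<eta> lam n" "\<eta> > 0"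
  shows "norm (score n (\<lambda>i. X i \<omega>) (\<lambda>i. Y i \<omega>) (theta_star M X Y)) \<le> \<eta> * lam n"
    and "norm ((gram n (\<lambda>i. X i \<omega>) - H) *v v) \<le> \<eta> * norm v"
proof -
  let ?s = "score n (\<lambda>i. X i \<omega>) (\<lambda>i. Y i \<omega>) (theta_star M X Y)"
  have "norm ?s \<le> (\<Sum>k\<in>UNIV. \<bar>?s $ k\<bar>)"
    by (rule norm_le_l1_cart)
  also have "\<dots> \<le> real CARD('p) * (\<eta> / real CARD('p) * lam n)"
    using assms(1) by (intro sum_bounded_above) (auto simp: good_event_def less_imp_le)
  finally show "norm ?s \<le> \<eta> * lam n"
    by simp
  let ?A = "gram n (\<lambda>i. X i \<omega>) - H"
  have "onorm ((*v) ?A) \<le> real CARD('p) * real CARD('p) * (\<eta> / (real CARD('p))\<^sup>2)"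
    using assms(1) by (intro onorm_le_matrix_component) (auto simp: good_event_def less_imp_le)
  also have "\<dots> = \<eta>"
    by (simp add: power2_eq_square)
  finally have "onorm ((*v) ?A) * norm v \<le> \<eta> * norm v"
    by (rule mult_right_mono) simp
  then show "norm (?A *v v) \<le> \<eta> * norm v"
    using onorm[OF matrix_vector_mul_bounded_linear, of ?A v] by simp
qed

end

section \<open>Selection consistency\<close>

text \<open>The dichotomy is read on the good event. If selection succeeds with probability tending
  to 1, it meets the good event, and the resulting inequality for \<open>\<kappa>\<close> is
  deterministic. If \<open>\<kappa> < 1\<close>, a small \<open>\<eta>\<close> excludes the failure
  branch, so the good event lies within correct selection.\<close>

lemma (in prob_space) rank_lasso_selection:
  fixes N :: "'e measure"
    and X :: "nat \<Rightarrow> 'a \<Rightarrow> real ^ ('s::finite + 'u::finite)"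
    and \<theta>hat :: "nat \<Rightarrow> 'a \<Rightarrow> real ^ ('s + 'u)"
  assumes model: "single_index_model M N X \<epsilon> g \<beta>" and supp_\<beta>: "supp \<beta> = range Inl"
    and lam: "\<And>n. n \<ge> 1 \<Longrightarrow> lam n > 0" "lam \<longlonglongrightarrow> 0"
      "filterlim (\<lambda>n. sqrt (real n) * lam n) at_top sequentially"
    and \<theta>hat_meas: "\<And>n. n \<ge> 1 \<Longrightarrow> \<theta>hat n \<in> borel_measurable M"
    and \<theta>hat: "\<And>n \<omega>. n \<ge> 1 \<Longrightarrow> \<omega> \<in> space M \<Longrightarrow>
        is_rank_lasso n (\<lambda>i. X i \<omega>) (\<lambda>i. response g \<beta> X \<epsilon> i \<omega>) (lam n) (\<theta>hat n \<omega>)"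
  defines "\<kappa> \<equiv> infnorm (irrepresentability_matrix (second_moment M (X 0))
      *v sign_vec (restrict_T (theta_star M X (response g \<beta> X \<epsilon>))))"
    and "selected \<equiv> \<lambda>n. {\<omega> \<in> space M. supp (\<theta>hat n \<omega>) = range Inl}"
  shows "(\<lambda>n. prob (selected n)) \<longlonglongrightarrow> 1 \<Longrightarrow> \<kappa> \<le> 1"
    and "\<kappa> < 1 \<Longrightarrow> (\<lambda>n. prob (selected n)) \<longlonglongrightarrow> 1"
proof -
  interpret single_index_model M N X \<epsilon> g \<beta>
    by (rule model)
  obtain \<gamma> where \<gamma>: "\<gamma> > 0" "theta_star M X Y = \<gamma> *\<^sub>R \<beta>"
    by (rule theta_star_proportional)
  then have supp: "supp (theta_star M X Y) = range Inl"
    using supp_\<beta> by (simp add: supp_def)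
  obtain K \<eta>0 where K: "K > 0" and \<eta>0: "\<eta>0 > 0"
    and dichotomy: "\<And>\<eta> l n x y \<theta>. \<lbrakk>0 < \<eta>; \<eta> \<le> \<eta>0; 0 < l; l \<le> \<eta>0; n \<ge> 1; is_rank_lasso n x y l \<theta>;
        norm (score n x y (theta_star M X Y)) \<le> \<eta> * l; \<And>v. norm ((gram n x - H) *v v) \<le> \<eta> * norm v\<rbrakk>
      \<Longrightarrow> if supp \<theta> = range Inl then \<kappa> \<le> 1 + K * \<eta> else 1 \<le> \<kappa> + K * \<eta>"
    unfolding \<kappa>_def using rank_lasso_selection_dichotomy[OF pos_def supp] by blast
  have good: "if \<omega> \<in> selected n then \<kappa> \<le> 1 + K * \<eta> else 1 \<le> \<kappa> + K * \<eta>"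
    if "0 < \<eta>" "\<eta> \<le> \<eta>0" "n \<ge> 1" "lam n \<le> \<eta>0" "\<omega> \<in> good_event \<eta> lam n" for \<eta> n \<omega>
  proof -
    have "\<omega> \<in> space M"
      using that(5) by (simp add: good_event_def)
    then show ?thesis
      using dichotomy[OF that(1,2) lam(1)[OF that(3)] that(4,3) \<theta>hat[OF that(3)]
          good_event_bounds[OF that(5,1)]] by (simp add: selected_def)
  qed
  have large: "\<forall>\<^sub>F n in sequentially. n \<ge> 1 \<and> lam n \<le> \<eta>0"
    using eventually_ge_at_top[of 1] order_tendstoD(2)[OF lam(2) \<eta>0]
    by eventually_elim simp
  have selected_meas: "selected n \<in> events" if "n \<ge> 1" for n
  proof -
    note [measurable] = \<theta>hat_meas[OF that]
    have "selected n = {\<omega> \<in> space M. \<forall>j. \<theta>hat n \<omega> $ j \<noteq> 0 \<longleftrightarrow> j \<in> range Inl}"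
      by (auto simp: selected_def supp_def)
    also have "\<dots> \<in> events"
      by measurable
    finally show ?thesis .
  qed
  show "\<kappa> \<le> 1" if sel: "(\<lambda>n. prob (selected n)) \<longlonglongrightarrow> 1"
  proof (rule field_le_epsilon)
    fix e :: real assume "e > 0"
    define \<eta> where "\<eta> = min \<eta>0 (e / K)"
    have \<eta>: "0 < \<eta>" "\<eta> \<le> \<eta>0" "K * \<eta> \<le> e"
      using \<open>e > 0\<close> K \<eta>0 by (auto simp: \<eta>_def min_def field_simps)
    have "\<forall>\<^sub>F n in sequentially. 1 / 2 < prob (selected n)"
      by (rule order_tendstoD(1)[OF sel]) simp
    moreover have "\<forall>\<^sub>F n in sequentially. 1 / 2 < prob (good_event \<eta> lam n)"
      by (rule order_tendstoD(1)[OF good_event_prob[OF \<eta>(1) lam(1,3)]]) simp_all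
    ultimately have "\<forall>\<^sub>F n in sequentially. \<kappa> \<le> 1 + K * \<eta>"
      using large
    proof eventually_elim
      case (elim n)
      \<comment> \<open>Two events of probability above \<open>1 / 2\<close> cannot be
        disjoint.\<close>
      have "selected n \<inter> good_event \<eta> lam n \<noteq> {}"
      proof
        assume "selected n \<inter> good_event \<eta> lam n = {}"
        then have "prob (selected n) + prob (good_event \<eta> lam n) = prob (selected n \<union> good_event \<eta> lam n)"
          using elim by (intro finite_measure_Union[symmetric] selected_meas good_event_measurable) auto
        with elim show False
          using prob_le_1[of "selected n \<union> good_event \<eta> lam n"] by simp
      qed
      then obtain \<omega> where "\<omega> \<in> selected n" "\<omega> \<in> good_event \<eta> lam n"
        by blast
      then show ?case
        using good[of \<eta> n \<omega>] \<eta> elim by simp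
    qed
    then show "\<kappa> \<le> 1 + e"
      using \<eta>(3) by (simp add: eventually_const_iff)
  qed
  show "(\<lambda>n. prob (selected n)) \<longlonglongrightarrow> 1" if "\<kappa> < 1"
  proof -
    \<comment> \<open>Half of the gap \<open>1 - \<kappa>\<close> is left for the error term
      \<open>K * \<eta>\<close>, so the failure branch becomes contradictory.\<close>
    define \<eta> where "\<eta> = min \<eta>0 ((1 - \<kappa>) / (2 * K))"
    have \<eta>: "0 < \<eta>" "\<eta> \<le> \<eta>0"
      using that K \<eta>0 by (auto simp: \<eta>_def)
    have "K * \<eta> \<le> K * ((1 - \<kappa>) / (2 * K))"
      using K by (intro mult_left_mono) (auto simp: \<eta>_def)
    then have small: "\<not> 1 \<le> \<kappa> + K * \<eta>"
      using that K by simp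
    show ?thesis
    proof (rule tendsto_sandwich[OF _ _ good_event_prob[OF \<eta>(1) lam(1,3)] tendsto_const])
      show "\<forall>\<^sub>F n in sequentially. prob (good_event \<eta> lam n) \<le> prob (selected n)"
        using large
      proof eventually_elim
        case (elim n)
        have "\<omega> \<in> selected n" if "\<omega> \<in> good_event \<eta> lam n" for \<omega>
          using good[of \<eta> n \<omega>] that elim \<eta> small by (simp split: if_splits)
        then show ?case
          using elim by (intro finite_measure_mono selected_meas) auto
      qed
    qed auto
  qed
qed

theorem theorem5:
  fixes M :: "'w measure" and N :: "'e measure"
    and X :: "nat \<Rightarrow> 'w \<Rightarrow> real ^ ('s::finite + 'u::finite)"
    and \<epsilon> :: "nat \<Rightarrow> 'w \<Rightarrow> 'e"
    and g :: "real \<Rightarrow> 'e \<Rightarrow> real"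
    and \<beta> :: "real ^ ('s + 'u)"
    and Y :: "nat \<Rightarrow> 'w \<Rightarrow> real"
    and H :: "real ^ ('s + 'u) ^ ('s + 'u)"
    and lam :: "nat \<Rightarrow> real"
    and \<theta>hat :: "nat \<Rightarrow> 'w \<Rightarrow> real ^ ('s + 'u)"
    and T :: "('s + 'u) set"
  defines "Y \<equiv> response g \<beta> X \<epsilon>"
    and "H \<equiv> second_moment M (X 0)"
    and "T \<equiv> supp \<beta>"
  assumes prob: "prob_space M"
    and X_meas: "\<And>i. X i \<in> borel_measurable M"
    and eps_meas: "\<And>i. \<epsilon> i \<in> measurable M N"
    and g_meas: "(\<lambda>(u, e). g u e) \<in> borel_measurable (borel \<Otimes>\<^sub>M N)"
    and T_eq: "T = range Inl"
    and indep: "prob_space.indep_vars M (\<lambda>_. borel \<Otimes>\<^sub>M N) (\<lambda>i \<omega>. (X i \<omega>, \<epsilon> i \<omega>)) UNIV"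
    and ident_distr: "\<And>i. distr M (borel \<Otimes>\<^sub>M N) (\<lambda>\<omega>. (X i \<omega>, \<epsilon> i \<omega>))
                         = distr M (borel \<Otimes>\<^sub>M N) (\<lambda>\<omega>. (X 0 \<omega>, \<epsilon> 0 \<omega>))"
    and X_abs_cont: "absolutely_continuous lborel (distr M borel (X 0))"
    and X_eps_indep: "indep_elements M borel (X 0) N (\<epsilon> 0)"
    and X_mean: "integrable M (X 0)" "(\<integral>\<omega>. X 0 \<omega> \<partial>M) = 0"
    and H_exists: "\<And>j k. integrable M (\<lambda>\<omega>. X 0 \<omega> $ j * X 0 \<omega> $ k)"
    and H_pos_def: "positive_definite H"
    and H_diag: "\<And>j. H $ j $ j = 1"
    and linearity: "\<And>\<theta>. integrable M (\<lambda>\<omega>. \<theta> \<bullet> X 0 \<omega>) \<and>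
        (\<exists>d. AE \<omega> in M. real_cond_exp M (sigma_of M (\<lambda>\<omega>. \<beta> \<bullet> X 0 \<omega>) borel) (\<lambda>\<omega>. \<theta> \<bullet> X 0 \<omega>) \<omega>
                         = d * (\<beta> \<bullet> X 0 \<omega>))"
    and F_increasing: "strict_mono (cdf (distr M borel (Y 0)))"
    and g_increasing: "\<And>e. e \<in> space N \<Longrightarrow> strict_mono (\<lambda>u. g u e)"
    and fourth_moment: "integrable M (\<lambda>\<omega>. norm (X 0 \<omega>) ^ 4)"
    and lam_pos: "\<And>n. n \<ge> 1 \<Longrightarrow> lam n > 0"
    and lam_lim: "lam \<longlonglongrightarrow> 0"
    and lam_rate: "filterlim (\<lambda>n. sqrt (real n) * lam n) at_top sequentially"
    and \<theta>hat_meas: "\<And>n. n \<ge> 1 \<Longrightarrow> \<theta>hat n \<in> borel_measurable M"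
    and \<theta>hat: "\<And>n \<omega>. n \<ge> 1 \<Longrightarrow> \<omega> \<in> space M \<Longrightarrow>
        is_rank_lasso n (\<lambda>i. X i \<omega>) (\<lambda>i. Y i \<omega>) (lam n) (\<theta>hat n \<omega>)"
  shows "((\<lambda>n. measure M {\<omega> \<in> space M. supp (\<theta>hat n \<omega>) = T}) \<longlonglongrightarrow> 1 \<longrightarrow>
          infnorm ((transpose (block2 H) ** matrix_inv (block1 H))
            *v sign_vec (restrict_T (theta_star M X Y))) \<le> 1)
       \<and> (infnorm ((transpose (block2 H) ** matrix_inv (block1 H))
            *v sign_vec (restrict_T (theta_star M X Y))) < 1 \<longrightarrow>
          (\<lambda>n. measure M {\<omega> \<in> space M. supp (\<theta>hat n \<omega>) = T}) \<longlonglongrightarrow> 1)"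
proof -
  interpret prob_space M
    by (rule prob)
  have supp_\<beta>: "supp \<beta> = range Inl"
    using T_eq by (simp add: T_def)
  then have "\<beta> $ Inl i \<noteq> 0" for i
    by (auto simp: supp_def)
  \<comment> \<open>The type \<open>'s\<close> is nonempty, so \<open>\<beta>\<close> has at least
    one nonzero coordinate.\<close>
  then have "\<beta> \<noteq> 0"
    by (metis zero_index)
  then have "single_index_model M N X \<epsilon> g \<beta>"
    using linearity
    by unfold_locales
      (rule X_meas eps_meas g_meas indep ident_distr X_eps_indep X_mean fourth_moment
        H_pos_def[unfolded H_def] F_increasing[unfolded Y_def] g_increasing | blast)+
  note selection = rank_lasso_selection[OF this supp_\<beta> lam_pos lam_lim lam_rate \<theta>hat_meas
      \<theta>hat[unfolded Y_def]]
  show ?thesis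
    unfolding T_eq H_def Y_def using selection unfolding irrepresentability_matrix_def by blast
qed

end
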